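(* Let $f\colon A\twoheadrightarrow B$ be an effective descent morphism (i.e. a regular epimorphism) in $\mathbb{MV}$. Then $f$ is a normal extension for the Galois structure $\Gamma$ if and only if $P(f)\colon P(A)\to P(B)$ is injective, or $P(A)=\mathbf{2}$ and $P(B)=\mathbf{1}$.
   Context: An MV-algebra is a set $A$ with a binary operation $\oplus$, a unary operation $\lnot$ and a constant $0$ such that $\oplus$ is associative and commutative, $x\oplus 0=x$, $\lnot\lnot x=x$, $x\oplus\lnot 0=\lnot 0$, and $\lnot(\lnot x\oplus y)\oplus y=\lnot(\lnot y\oplus x)\oplus x$. Morphisms are the maps preserving $\oplus,\lnot,0$; $\mathbb{MV}$ is the resulting category. Its terminal object $\mathbf{1}$ is the one-element algebra and its initial object $\mathbf{2}$ is the algebra $\{0,1\}$ (equalities with $\mathbf{1}$, $\mathbf{2}$ are up to isomorphism). Regular epimorphisms in $\mathbb{MV}$ are the surjective morphisms. Put $1=\lnot 0$, $x\ominus y=\lnot(\lnot x\oplus y)$, $d(x,y)=(x\ominus y)\oplus(y\ominus x)$, and $x\le y$ iff $\lnot x\oplus y=1$. An ideal of $A$ is a subset $I\subseteq A$ containing $0$, closed under $\oplus$, and such that $x\in I$ and $y\le x$ imply $y\in I$; it is proper if $I\ne A$. For an ideal $I$, $A/I$ is the quotient of $A$ by the congruence $x\sim y\iff d(x,y)\in I$. $\mathrm{Rad}(A)$ is the intersection of all maximal (proper) ideals of $A$ (with $\mathrm{Rad}(A)=A=\{0\}$ if $A=\mathbf{1}$). For $T\subseteq A$, $\lnot T=\{x\in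 A\mid\lnot x\in T\}$. $P(A)=\mathrm{Rad}(A)\cup\lnot\mathrm{Rad}(A)$ is a subalgebra of $A$, and $P(f)\colon P(A)\to P(B)$ is the restriction of $f$. $S(A)=A/\mathrm{Rad}(A)$, $S(f)([a])=[f(a)]$, and $\eta_A\colon A\to S(A)$ is the quotient projection. $\Gamma$ denotes the Galois structure given by the adjunction between $S\colon\mathbb{MV}\to s\mathbb{MV}$ and the inclusion $i\colon s\mathbb{MV}\hookrightarrow\mathbb{MV}$ of the full subcategory of semisimple MV-algebras (those with $\mathrm{Rad}(A)=\{0\}$), relatively to the classes of all arrows. A trivial extension for $\Gamma$ is a morphism $f\colon A\to B$ such that the square $S(f)\,\eta_A=\eta_B\,f$ is a pullback in $\mathbb{MV}$. An effective descent morphism is an arrow $f\colon A\to B$ such that the change-of-base functor $f^*\colon\mathbb{MV}/B\to\mathbb{MV}/A$ is monadic; in $\mathbb{MV}$ these are exactly the regular epimorphisms. A normal extension for $\Gamma$ is an effective descent morphism whose kernel pair projections are trivial extensions. *)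

theory Defs
  imports "HOL-Algebra.Congruence"
begin

section \<open>MV-algebras and their morphisms\<close>

record 'a mv = "'a partial_object" +
  mv_plus :: "'a \<Rightarrow> 'a \<Rightarrow> 'a" (infixl \<open>\<oplus>\<index>\<close> 65)
  mv_neg :: "'a \<Rightarrow> 'a" (\<open>\<^bold>\<not>\<index> _\<close> [81] 80)
  mv_zero :: 'a (\<open>\<zero>\<index>\<close>)

locale mv_algebra =
  fixes A :: "'a mv" (structure)
  assumes plus_closed: "\<lbrakk>x \<in> carrier A; y \<in> carrier A\<rbrakk> \<Longrightarrow> x \<oplus> y \<in> carrier A"
    and neg_closed: "x \<in> carrier A \<Longrightarrow> \<^bold>\<not> x \<in> carrier A"
    and zero_closed: "\<zero> \<in> carrier A"
    and plus_assoc: "\<lbrakk>x \<in> carrier A; y \<in> carrier A; z \<in> carrier A\<rbrakk>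
          \<Longrightarrow> (x \<oplus> y) \<oplus> z = x \<oplus> (y \<oplus> z)"
    and plus_comm: "\<lbrakk>x \<in> carrier A; y \<in> carrier A\<rbrakk> \<Longrightarrow> x \<oplus> y = y \<oplus> x"
    and plus_zero: "x \<in> carrier A \<Longrightarrow> x \<oplus> \<zero> = x"
    and neg_neg: "x \<in> carrier A \<Longrightarrow> \<^bold>\<not> (\<^bold>\<not> x) = x"
    and plus_neg_zero: "x \<in> carrier A \<Longrightarrow> x \<oplus> \<^bold>\<not> \<zero> = \<^bold>\<not> \<zero>"
    and lukasiewicz: "\<lbrakk>x \<in> carrier A; y \<in> carrier A\<rbrakk>
          \<Longrightarrow> \<^bold>\<not> (\<^bold>\<not> x \<oplus> y) \<oplus> y = \<^bold>\<not> (\<^bold>\<not> y \<oplus> x) \<oplus> x"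

text \<open>Morphisms are only determined by their values on the carrier, so equality of morphisms
  is always stated pointwise on the carrier below.\<close>

definition mv_hom :: "'a mv \<Rightarrow> 'b mv \<Rightarrow> ('a \<Rightarrow> 'b) set" where
  "mv_hom A B = {f \<in> carrier A \<rightarrow> carrier B.
     (\<forall>x\<in>carrier A. \<forall>y\<in>carrier A. f (x \<oplus>\<^bsub>A\<^esub> y) = f x \<oplus>\<^bsub>B\<^esub> f y) \<and>
     (\<forall>x\<in>carrier A. f (\<^bold>\<not>\<^bsub>A\<^esub> x) = \<^bold>\<not>\<^bsub>B\<^esub> f x) \<and>
     f \<zero>\<^bsub>A\<^esub> = \<zero>\<^bsub>B\<^esub>}"

definition mv_iso :: "'a mv \<Rightarrow> 'b mv \<Rightarrow> ('a \<Rightarrow> 'b) set" where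
  "mv_iso A B = {f \<in> mv_hom A B. bij_betw f (carrier A) (carrier B)}"

definition mv_isomorphic :: "'a mv \<Rightarrow> 'b mv \<Rightarrow> bool" where
  "mv_isomorphic A B \<longleftrightarrow> mv_iso A B \<noteq> {}"

definition one_mv :: "unit mv" where
  "one_mv = \<lparr>carrier = UNIV, mv_plus = (\<lambda>_ _. ()), mv_neg = (\<lambda>_. ()), mv_zero = ()\<rparr>"

definition two_mv :: "bool mv" where
  "two_mv = \<lparr>carrier = UNIV, mv_plus = (\<or>), mv_neg = Not, mv_zero = False\<rparr>"


section \<open>Ideals, radical, and the functors $P$ and $S$\<close>

definition mv_one :: "'a mv \<Rightarrow> 'a" (\<open>\<one>\<index>\<close>) where
  "\<one>\<^bsub>A\<^esub> = \<^bold>\<not>\<^bsub>A\<^esub> \<zero>\<^bsub>A\<^esub>"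

definition mv_minus :: "'a mv \<Rightarrow> 'a \<Rightarrow> 'a \<Rightarrow> 'a" (infixl \<open>\<ominus>\<index>\<close> 65) where
  "x \<ominus>\<^bsub>A\<^esub> y = \<^bold>\<not>\<^bsub>A\<^esub> (\<^bold>\<not>\<^bsub>A\<^esub> x \<oplus>\<^bsub>A\<^esub> y)"

definition mv_dist :: "'a mv \<Rightarrow> 'a \<Rightarrow> 'a \<Rightarrow> 'a" where
  "mv_dist A x y = (x \<ominus>\<^bsub>A\<^esub> y) \<oplus>\<^bsub>A\<^esub> (y \<ominus>\<^bsub>A\<^esub> x)"

definition mv_le :: "'a mv \<Rightarrow> 'a \<Rightarrow> 'a \<Rightarrow> bool" where
  "mv_le A x y \<longleftrightarrow> \<^bold>\<not>\<^bsub>A\<^esub> x \<oplus>\<^bsub>A\<^esub> y = \<one>\<^bsub>A\<^esub>"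

definition mv_ideal :: "'a mv \<Rightarrow> 'a set \<Rightarrow> bool" where
  "mv_ideal A I \<longleftrightarrow> I \<subseteq> carrier A \<and> \<zero>\<^bsub>A\<^esub> \<in> I \<and>
     (\<forall>x\<in>I. \<forall>y\<in>I. x \<oplus>\<^bsub>A\<^esub> y \<in> I) \<and>
     (\<forall>x\<in>I. \<forall>y\<in>carrier A. mv_le A y x \<longrightarrow> y \<in> I)"

definition maximal_mv_ideal :: "'a mv \<Rightarrow> 'a set \<Rightarrow> bool" where
  "maximal_mv_ideal A M \<longleftrightarrow> mv_ideal A M \<and> M \<noteq> carrier A \<and>
     (\<forall>J. mv_ideal A J \<and> M \<subseteq> J \<and> J \<noteq> carrier A \<longrightarrow> J = M)"

text \<open>The one-element algebra has no proper ideal, so there the (empty) intersection, taken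
  inside the carrier, is the whole algebra.\<close>

definition Rad :: "'a mv \<Rightarrow> 'a set" where
  "Rad A = {x \<in> carrier A. \<forall>M. maximal_mv_ideal A M \<longrightarrow> x \<in> M}"

definition P_alg :: "'a mv \<Rightarrow> 'a mv" where
  "P_alg A = A\<lparr>carrier := Rad A \<union> {x \<in> carrier A. \<^bold>\<not>\<^bsub>A\<^esub> x \<in> Rad A}\<rparr>"

definition P_map :: "'a mv \<Rightarrow> ('a \<Rightarrow> 'b) \<Rightarrow> 'a \<Rightarrow> 'b" where
  "P_map A f = restrict f (carrier (P_alg A))"

definition ideal_cong :: "'a mv \<Rightarrow> 'a set \<Rightarrow> ('a \<times> 'a) set" where
  "ideal_cong A I = {(x, y) \<in> carrier A \<times> carrier A. mv_dist A x y \<in> I}"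

definition mv_quotient :: "'a mv \<Rightarrow> 'a set \<Rightarrow> 'a set mv" where
  "mv_quotient A I =
     \<lparr>carrier = carrier A // ideal_cong A I,
      mv_plus = (\<lambda>X Y. \<Union>x\<in>X. \<Union>y\<in>Y. ideal_cong A I `` {x \<oplus>\<^bsub>A\<^esub> y}),
      mv_neg = (\<lambda>X. \<Union>x\<in>X. ideal_cong A I `` {\<^bold>\<not>\<^bsub>A\<^esub> x}),
      mv_zero = ideal_cong A I `` {\<zero>\<^bsub>A\<^esub>}\<rparr>"

definition S_alg :: "'a mv \<Rightarrow> 'a set mv" where
  "S_alg A = mv_quotient A (Rad A)"

definition eta :: "'a mv \<Rightarrow> 'a \<Rightarrow> 'a set" where
  "eta A x = ideal_cong A (Rad A) `` {x}"

text \<open>As for the operations of the quotient, the union runs over classes that all coincide: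
  the value at the class of \<open>a\<close> is the class of \<open>f a\<close>.\<close>

definition S_map :: "'b mv \<Rightarrow> ('a \<Rightarrow> 'b) \<Rightarrow> 'a set \<Rightarrow> 'b set" where
  "S_map B f X = (\<Union>x\<in>X. eta B (f x))"


section \<open>Pullbacks\<close>

definition mv_pullback :: "'a mv \<Rightarrow> ('a \<Rightarrow> 'c) \<Rightarrow> 'b mv \<Rightarrow> ('b \<Rightarrow> 'c) \<Rightarrow> ('a \<times> 'b) mv" where
  "mv_pullback X g Y h =
     \<lparr>carrier = {(x, y) \<in> carrier X \<times> carrier Y. g x = h y},
      mv_plus = (\<lambda>(x, y) (x', y'). (x \<oplus>\<^bsub>X\<^esub> x', y \<oplus>\<^bsub>Y\<^esub> y')),
      mv_neg = (\<lambda>(x, y). (\<^bold>\<not>\<^bsub>X\<^esub> x, \<^bold>\<not>\<^bsub>Y\<^esub> y)),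
      mv_zero = (\<zero>\<^bsub>X\<^esub>, \<zero>\<^bsub>Y\<^esub>)\<rparr>"

text \<open>The commutative square with sides \<open>p : Q \<rightarrow> X\<close>, \<open>q : Q \<rightarrow> Y\<close>,
  \<open>g : X \<rightarrow> Z\<close>, \<open>h : Y \<rightarrow> Z\<close> is a pullback when the canonical comparison
  with the standard pullback is an isomorphism. The universal property itself quantifies over test
  algebras on arbitrary types; it is derived polymorphically in \<open>is_pullback_universal\<close>,
  and \<open>is_pullbackI\<close> is the converse.\<close>

definition is_pullback ::
  "'q mv \<Rightarrow> 'a mv \<Rightarrow> 'b mv \<Rightarrow> 'c mv \<Rightarrow>
   ('q \<Rightarrow> 'a) \<Rightarrow> ('q \<Rightarrow> 'b) \<Rightarrow> ('a \<Rightarrow> 'c) \<Rightarrow> ('b \<Rightarrow> 'c) \<Rightarrow> bool" where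
  "is_pullback Q X Y Z p q g h \<longleftrightarrow>
     p \<in> mv_hom Q X \<and> q \<in> mv_hom Q Y \<and> g \<in> mv_hom X Z \<and> h \<in> mv_hom Y Z \<and>
     (\<forall>z\<in>carrier Q. g (p z) = h (q z)) \<and>
     (\<lambda>z. (p z, q z)) \<in> mv_iso Q (mv_pullback X g Y h)"

lemma mv_homI:
  assumes "\<And>x. x \<in> carrier A \<Longrightarrow> f x \<in> carrier B"
    and "\<And>x y. x \<in> carrier A \<Longrightarrow> y \<in> carrier A \<Longrightarrow> f (x \<oplus>\<^bsub>A\<^esub> y) = f x \<oplus>\<^bsub>B\<^esub> f y"
    and "\<And>x. x \<in> carrier A \<Longrightarrow> f (\<^bold>\<not>\<^bsub>A\<^esub> x) = \<^bold>\<not>\<^bsub>B\<^esub> f x"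
    and "f \<zero>\<^bsub>A\<^esub> = \<zero>\<^bsub>B\<^esub>"
  shows "f \<in> mv_hom A B"
  using assms by (auto simp: mv_hom_def)

lemma mv_homD:
  assumes "f \<in> mv_hom A B"
  shows "\<And>x. x \<in> carrier A \<Longrightarrow> f x \<in> carrier B"
    and "\<And>x y. x \<in> carrier A \<Longrightarrow> y \<in> carrier A \<Longrightarrow> f (x \<oplus>\<^bsub>A\<^esub> y) = f x \<oplus>\<^bsub>B\<^esub> f y"
    and "\<And>x. x \<in> carrier A \<Longrightarrow> f (\<^bold>\<not>\<^bsub>A\<^esub> x) = \<^bold>\<not>\<^bsub>B\<^esub> f x"
    and "f \<zero>\<^bsub>A\<^esub> = \<zero>\<^bsub>B\<^esub>"
  using assms by (auto simp: mv_hom_def)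

lemma mv_hom_comp:
  assumes "f \<in> mv_hom A B" "g \<in> mv_hom B C"
  shows "(\<lambda>x. g (f x)) \<in> mv_hom A C"
  using assms by (auto simp: mv_hom_def Pi_iff)

lemma mv_pullback_simps [simp]:
  "(x, y) \<in> carrier (mv_pullback X g Y h) \<longleftrightarrow> x \<in> carrier X \<and> y \<in> carrier Y \<and> g x = h y"
  "(x, y) \<oplus>\<^bsub>mv_pullback X g Y h\<^esub> (x', y') = (x \<oplus>\<^bsub>X\<^esub> x', y \<oplus>\<^bsub>Y\<^esub> y')"
  "\<^bold>\<not>\<^bsub>mv_pullback X g Y h\<^esub> (x, y) = (\<^bold>\<not>\<^bsub>X\<^esub> x, \<^bold>\<not>\<^bsub>Y\<^esub> y)"
  "\<zero>\<^bsub>mv_pullback X g Y h\<^esub> = (\<zero>\<^bsub>X\<^esub>, \<zero>\<^bsub>Y\<^esub>)"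
  by (simp_all add: mv_pullback_def)

lemma mv_algebra_pullback:
  assumes "mv_algebra X" "mv_algebra Y" "g \<in> mv_hom X Z" "h \<in> mv_hom Y Z"
  shows "mv_algebra (mv_pullback X g Y h)"
proof -
  interpret X: mv_algebra X by fact
  interpret Y: mv_algebra Y by fact
  note H = mv_homD[OF assms(3)] mv_homD[OF assms(4)]
  show ?thesis
  proof (unfold_locales, goal_cases)
    case (1 x y) then show ?case
      by (cases x; cases y) (simp add: H X.plus_closed Y.plus_closed)
  next
    case (2 x) then show ?case
      by (cases x) (simp add: H X.neg_closed Y.neg_closed)
  next
    case 3 show ?case by (simp add: H X.zero_closed Y.zero_closed)
  next
    case (4 x y z) then show ?case
      by (cases x; cases y; cases z) (simp add: X.plus_assoc Y.plus_assoc)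
  next
    case (5 x y) then show ?case
      by (cases x; cases y) (simp add: X.plus_comm Y.plus_comm)
  next
    case (6 x) then show ?case by (cases x) (simp add: X.plus_zero Y.plus_zero)
  next
    case (7 x) then show ?case by (cases x) (simp add: X.neg_neg Y.neg_neg)
  next
    case (8 x) then show ?case by (cases x) (simp add: X.plus_neg_zero Y.plus_neg_zero)
  next
    case (9 x y) then show ?case
      by (cases x; cases y) (simp add: X.lukasiewicz Y.lukasiewicz)
  qed
qed

lemma mv_iso_inverse:
  assumes Q: "mv_algebra Q" and k: "k \<in> mv_iso Q R"
  shows "inv_into (carrier Q) k \<in> mv_iso R Q"
proof -
  interpret mv_algebra Q by fact
  have hom: "k \<in> mv_hom Q R" and bij: "bij_betw k (carrier Q) (carrier R)"
    using k by (auto simp: mv_iso_def)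
  note H = mv_homD[OF hom]
  let ?i = "inv_into (carrier Q) k"
  have bi: "bij_betw ?i (carrier R) (carrier Q)" by (rule bij_betw_inv_into[OF bij])
  have ik: "?i (k x) = x" if "x \<in> carrier Q" for x
    using bij that by (rule bij_betw_inv_into_left)
  have ki: "\<exists>x\<in>carrier Q. y = k x" if "y \<in> carrier R" for y
    using bij that by (auto simp: bij_betw_def)
  have "?i \<in> mv_hom R Q"
  proof (rule mv_homI)
    show "?i x \<in> carrier Q" if "x \<in> carrier R" for x
      using ki[OF that] ik by auto
    show "?i (x \<oplus>\<^bsub>R\<^esub> y) = ?i x \<oplus>\<^bsub>Q\<^esub> ?i y" if "x \<in> carrier R" "y \<in> carrier R" for x y
      using ki[OF that(1)] ki[OF that(2)] by (auto simp: ik H(2)[symmetric] plus_closed)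
    show "?i (\<^bold>\<not>\<^bsub>R\<^esub> x) = \<^bold>\<not>\<^bsub>Q\<^esub> ?i x" if "x \<in> carrier R" for x
      using ki[OF that] by (auto simp: ik H(3)[symmetric] neg_closed)
    show "?i \<zero>\<^bsub>R\<^esub> = \<zero>\<^bsub>Q\<^esub>" using ik[OF zero_closed] by (simp add: H)
  qed
  with bi show ?thesis by (simp add: mv_iso_def)
qed

lemma is_pullback_universal:
  assumes Q: "mv_algebra Q" and pb: "is_pullback Q X Y Z p q g h"
    and u: "u \<in> mv_hom T X" and v: "v \<in> mv_hom T Y"
    and uv: "\<And>t. t \<in> carrier T \<Longrightarrow> g (u t) = h (v t)"
  shows "\<exists>w\<in>mv_hom T Q. \<forall>t\<in>carrier T. p (w t) = u t \<and> q (w t) = v t"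
    and "\<lbrakk>w \<in> mv_hom T Q; w' \<in> mv_hom T Q;
          \<And>t. t \<in> carrier T \<Longrightarrow> p (w t) = p (w' t) \<and> q (w t) = q (w' t); t \<in> carrier T\<rbrakk>
         \<Longrightarrow> w t = w' t"
proof -
  let ?k = "\<lambda>z. (p z, q z)"
  let ?i = "inv_into (carrier Q) ?k"
  let ?R = "mv_pullback X g Y h"
  have iso: "?k \<in> mv_iso Q ?R" using pb by (simp add: is_pullback_def)
  then have bij: "bij_betw ?k (carrier Q) (carrier ?R)" by (simp add: mv_iso_def)
  have uvhom: "(\<lambda>t. (u t, v t)) \<in> mv_hom T ?R"
    using u v uv by (auto intro!: mv_homI dest: mv_homD)
  have "?i \<in> mv_hom ?R Q" using mv_iso_inverse[OF Q iso] by (simp add: mv_iso_def)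
  then have w: "(\<lambda>t. ?i (u t, v t)) \<in> mv_hom T Q" by (rule mv_hom_comp[OF uvhom])
  have "?k (?i (u t, v t)) = (u t, v t)" if "t \<in> carrier T" for t
    using bij mv_homD(1)[OF uvhom that] by (rule bij_betw_inv_into_right)
  then show "\<exists>w\<in>mv_hom T Q. \<forall>t\<in>carrier T. p (w t) = u t \<and> q (w t) = v t"
    using w by (intro bexI[of _ "\<lambda>t. ?i (u t, v t)"]) auto
  show "w t = w' t" if "w \<in> mv_hom T Q" "w' \<in> mv_hom T Q"
      "\<And>t. t \<in> carrier T \<Longrightarrow> p (w t) = p (w' t) \<and> q (w t) = q (w' t)" "t \<in> carrier T"
    using inj_onD[OF bij_betw_imp_inj_on[OF bij], of "w t" "w' t"] that(3)[OF that(4)]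
      mv_homD(1)[OF that(1,4)] mv_homD(1)[OF that(2,4)] by simp
qed

lemma is_pullbackI:
  fixes Q :: "'q mv" and X :: "'a mv" and Y :: "'b mv"
  assumes alg: "mv_algebra Q" "mv_algebra X" "mv_algebra Y"
    and hom: "p \<in> mv_hom Q X" "q \<in> mv_hom Q Y" "g \<in> mv_hom X Z" "h \<in> mv_hom Y Z"
    and comm: "\<And>z. z \<in> carrier Q \<Longrightarrow> g (p z) = h (q z)"
    and ex: "\<And>(T :: ('a \<times> 'b) mv) u v. \<lbrakk>mv_algebra T; u \<in> mv_hom T X; v \<in> mv_hom T Y;
          \<And>t. t \<in> carrier T \<Longrightarrow> g (u t) = h (v t)\<rbrakk>
        \<Longrightarrow> \<exists>w\<in>mv_hom T Q. \<forall>t\<in>carrier T. p (w t) = u t \<and> q (w t) = v t"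
    and uniq: "\<And>(T :: 'q mv) w w' t. \<lbrakk>mv_algebra T; w \<in> mv_hom T Q; w' \<in> mv_hom T Q;
          \<And>t. t \<in> carrier T \<Longrightarrow> p (w t) = p (w' t) \<and> q (w t) = q (w' t); t \<in> carrier T\<rbrakk>
        \<Longrightarrow> w t = w' t"
  shows "is_pullback Q X Y Z p q g h"
proof -
  let ?k = "\<lambda>z. (p z, q z)"
  let ?R = "mv_pullback X g Y h"
  have khom: "?k \<in> mv_hom Q ?R"
    using hom comm by (auto intro!: mv_homI dest: mv_homD)
  have R: "mv_algebra ?R" using alg hom by (intro mv_algebra_pullback)
  have "fst \<in> mv_hom ?R X" "snd \<in> mv_hom ?R Y" by (auto intro!: mv_homI)
  from ex[OF R this] obtain w where w: "w \<in> mv_hom ?R Q"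
    and wt: "\<And>t. t \<in> carrier ?R \<Longrightarrow> p (w t) = fst t \<and> q (w t) = snd t" by force
  have kw: "?k (w t) = t" if "t \<in> carrier ?R" for t using wt[OF that] by simp
  have wk: "w (?k z) = z" if "z \<in> carrier Q" for z
  proof (rule uniq[OF alg(1), of "\<lambda>z. w (?k z)" "\<lambda>z. z"])
    show "(\<lambda>z. w (?k z)) \<in> mv_hom Q Q" by (rule mv_hom_comp[OF khom w])
    show "(\<lambda>z. z) \<in> mv_hom Q Q" by (auto intro!: mv_homI)
    show "p (w (?k t)) = p t \<and> q (w (?k t)) = q t" if "t \<in> carrier Q" for t
      using kw[OF mv_homD(1)[OF khom that]] by simp
  qed fact
  have "bij_betw ?k (carrier Q) (carrier ?R)"
    by (rule bij_betw_byWitness[where f' = w])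
       (use kw wk khom w in \<open>auto dest: mv_homD(1)\<close>)
  with khom hom comm show ?thesis by (simp add: is_pullback_def mv_iso_def)
qed


section \<open>Effective descent morphisms\<close>

text \<open>For \<open>f : A \<rightarrow> B\<close>, the functor \<open>f\<^sup>* : MV/B \<rightarrow> MV/A\<close>, which sends
  \<open>(D, \<delta>)\<close> to \<open>(D \<times>\<^sub>B A, snd)\<close>, has the left adjoint
  \<open>(C, \<gamma>) \<mapsto> (C, f \<circ> \<gamma>)\<close>. The resulting monad \<open>T\<close> on \<open>MV/A\<close> has
  \<open>T (C, \<gamma>) = (C \<times>\<^sub>B A, snd)\<close>, acts on morphisms by \<open>h \<mapsto> map_prod h id\<close>, has
  unit \<open>c \<mapsto> (c, \<gamma> c)\<close> and multiplication \<open>((c, a), a') \<mapsto> (c, a')\<close>.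
  The counit of the adjunction is \<open>fst : D \<times>\<^sub>B A \<rightarrow> D\<close>.\<close>

definition mv_over :: "'a mv \<Rightarrow> 'd mv \<Rightarrow> ('d \<Rightarrow> 'a) \<Rightarrow> bool" where
  "mv_over B D \<delta> \<longleftrightarrow> mv_algebra D \<and> \<delta> \<in> mv_hom D B"

definition slice_hom ::
  "'d mv \<Rightarrow> ('d \<Rightarrow> 'a) \<Rightarrow> 'e mv \<Rightarrow> ('e \<Rightarrow> 'a) \<Rightarrow> ('d \<Rightarrow> 'e) set" where
  "slice_hom D \<delta> E \<epsilon> = {h \<in> mv_hom D E. \<forall>x\<in>carrier D. \<epsilon> (h x) = \<delta> x}"

definition change_of_base :: "'a mv \<Rightarrow> ('a \<Rightarrow> 'b) \<Rightarrow> 'd mv \<Rightarrow> ('d \<Rightarrow> 'b) \<Rightarrow> ('d \<times> 'a) mv" where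
  "change_of_base A f D \<delta> = mv_pullback D \<delta> A f"

definition descent_monad :: "'a mv \<Rightarrow> ('a \<Rightarrow> 'b) \<Rightarrow> 'c mv \<Rightarrow> ('c \<Rightarrow> 'a) \<Rightarrow> ('c \<times> 'a) mv" where
  "descent_monad A f C \<gamma> = change_of_base A f C (f \<circ> \<gamma>)"

text \<open>Eilenberg--Moore algebras of \<open>T\<close> and their morphisms.\<close>

definition descent_algebra ::
  "'a mv \<Rightarrow> ('a \<Rightarrow> 'b) \<Rightarrow> 'c mv \<Rightarrow> ('c \<Rightarrow> 'a) \<Rightarrow> ('c \<times> 'a \<Rightarrow> 'c) \<Rightarrow> bool" where
  "descent_algebra A f C \<gamma> \<xi> \<longleftrightarrow>
     mv_over A C \<gamma> \<and>
     \<xi> \<in> slice_hom (descent_monad A f C \<gamma>) snd C \<gamma> \<and>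
     (\<forall>c\<in>carrier C. \<xi> (c, \<gamma> c) = c) \<and>
     (\<forall>z\<in>carrier (descent_monad A f (descent_monad A f C \<gamma>) snd).
        \<xi> (map_prod \<xi> id z) = \<xi> (map_prod fst id z))"

definition descent_algebra_hom ::
  "'a mv \<Rightarrow> ('a \<Rightarrow> 'b) \<Rightarrow>
   'c mv \<Rightarrow> ('c \<Rightarrow> 'a) \<Rightarrow> ('c \<times> 'a \<Rightarrow> 'c) \<Rightarrow>
   'e mv \<Rightarrow> ('e \<Rightarrow> 'a) \<Rightarrow> ('e \<times> 'a \<Rightarrow> 'e) \<Rightarrow> ('c \<Rightarrow> 'e) set" where
  "descent_algebra_hom A f C \<gamma> \<xi> E \<epsilon> \<zeta> =
     {h \<in> slice_hom C \<gamma> E \<epsilon>.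
        \<forall>z\<in>carrier (descent_monad A f C \<gamma>). h (\<xi> z) = \<zeta> (map_prod h id z)}"

text \<open>The comparison functor sends \<open>(D, \<delta>)\<close> to \<open>f\<^sup>* (D, \<delta>)\<close> with structure map
  \<open>f\<^sup>*\<close> of the counit, i.e. \<open>map_prod fst id\<close>, and \<open>g\<close> to \<open>map_prod g id\<close>. Monadicity
  says that this functor is full, faithful and essentially surjective. The type \<open>'u\<close> of the
  carriers of \<open>A\<close> and \<open>B\<close> plays the role of the universe from which the objects of the slice
  categories are taken; by \<open>effective_descent_iff_surj\<close> the notion does not depend on it.\<close>

definition effective_descent :: "'u mv \<Rightarrow> 'u mv \<Rightarrow> ('u \<Rightarrow> 'u) \<Rightarrow> bool" where
  "effective_descent A B f \<longleftrightarrow>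
     f \<in> mv_hom A B \<and>
     \<comment> \<open>full\<close>
     (\<forall>(D :: 'u mv) \<delta> (E :: 'u mv) \<epsilon> h. mv_over B D \<delta> \<and> mv_over B E \<epsilon> \<and>
        h \<in> descent_algebra_hom A f
              (change_of_base A f D \<delta>) snd (map_prod fst id)
              (change_of_base A f E \<epsilon>) snd (map_prod fst id) \<longrightarrow>
        (\<exists>g\<in>slice_hom D \<delta> E \<epsilon>.
           \<forall>z\<in>carrier (change_of_base A f D \<delta>). h z = map_prod g id z)) \<and>
     \<comment> \<open>faithful\<close>
     (\<forall>(D :: 'u mv) \<delta> (E :: 'u mv) \<epsilon>. mv_over B D \<delta> \<and> mv_over B E \<epsilon> \<longrightarrow>
        (\<forall>g\<in>slice_hom D \<delta> E \<epsilon>. \<forall>g'\<in>slice_hom D \<delta> E \<epsilon>.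
           (\<forall>z\<in>carrier (change_of_base A f D \<delta>). map_prod g id z = map_prod g' id z) \<longrightarrow>
           (\<forall>x\<in>carrier D. g x = g' x))) \<and>
     \<comment> \<open>essentially surjective\<close>
     (\<forall>(C :: 'u mv) \<gamma> \<xi>. descent_algebra A f C \<gamma> \<xi> \<longrightarrow>
        (\<exists>(D :: 'u mv) \<delta>. mv_over B D \<delta> \<and>
           (\<exists>h\<in>descent_algebra_hom A f
                 (change_of_base A f D \<delta>) snd (map_prod fst id) C \<gamma> \<xi>.
              bij_betw h (carrier (change_of_base A f D \<delta>)) (carrier C))))"

lemma mv_algebra_image:
  fixes C :: "'c mv" and D :: "'d mv"
  assumes C: "mv_algebra C" and r: "r \<in> mv_hom C D" and surj: "carrier D = r ` carrier C"
  shows "mv_algebra D"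
proof -
  interpret mv_algebra C by fact
  note H = mv_homD(2-4)[OF r, symmetric]
  note cl = plus_closed neg_closed zero_closed
  have ex: "\<exists>a\<in>carrier C. x = r a" if "x \<in> carrier D" for x
    using that by (auto simp: surj)
  have rD: "r a \<in> carrier D" if "a \<in> carrier C" for a
    using that by (simp add: surj)
  show ?thesis
  proof (unfold_locales, goal_cases)
    case (1 x y) then show ?case by (auto dest!: ex simp: H cl rD)
  next
    case (2 x) then show ?case by (auto dest!: ex simp: H cl rD)
  next
    case 3 show ?case by (simp add: H cl rD)
  next
    case (4 x y z) then show ?case by (auto dest!: ex simp: H cl plus_assoc)
  next
    case (5 x y)
    then obtain a b where "a \<in> carrier C" "b \<in> carrier C" "x = r a" "y = r b"
      by (blast dest: ex)
    then show ?case using plus_comm[of a b] by (simp add: H)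
  next
    case (6 x) then show ?case by (auto dest!: ex simp: H cl plus_zero)
  next
    case (7 x) then show ?case by (auto dest!: ex simp: H cl neg_neg)
  next
    case (8 x) then show ?case by (auto dest!: ex simp: H cl plus_neg_zero)
  next
    case (9 x y)
    then obtain a b where "a \<in> carrier C" "b \<in> carrier C" "x = r a" "y = r b"
      by (blast dest: ex)
    then show ?case using lukasiewicz[of a b] by (simp add: H cl)
  qed
qed

lemma effective_descent_imp_surj:
  fixes A B :: "'u mv"
  assumes A: "mv_algebra A" and B: "mv_algebra B" and ed: "effective_descent A B f"
  shows "f ` carrier A = carrier B"
proof -
  have f: "f \<in> mv_hom A B" using ed by (simp add: effective_descent_def)
  note H = mv_homD[OF f]
  let ?E = "B\<lparr>carrier := f ` carrier A\<rparr>"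
  have "f \<in> mv_hom A ?E" using H by (auto intro!: mv_homI)
  from mv_algebra_image[OF A this] have E: "mv_algebra ?E" by simp
  have "mv_over B B id" "mv_over B ?E id"
    using B E H(1) by (auto simp: mv_over_def intro!: mv_homI)
  moreover have "id \<in> descent_algebra_hom A f
      (change_of_base A f B id) snd (map_prod fst id)
      (change_of_base A f ?E id) snd (map_prod fst id)"
    by (auto simp: descent_algebra_hom_def slice_hom_def change_of_base_def intro!: mv_homI)
  ultimately obtain g where "g \<in> slice_hom B id ?E id"
    using ed unfolding effective_descent_def by blast
  then have "\<And>x. x \<in> carrier B \<Longrightarrow> x \<in> f ` carrier A"
    by (auto simp: slice_hom_def dest: mv_homD(1))
  with H(1) show ?thesis by auto
qed

lemma surj_imp_effective_descent:
  fixes A B :: "'u mv"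
  assumes A: "mv_algebra A" and B: "mv_algebra B" and f: "f \<in> mv_hom A B"
    and surj: "f ` carrier A = carrier B"
  shows "effective_descent A B f"
proof -
  interpret A: mv_algebra A by fact
  note H = mv_homD[OF f]
  have lift: "\<exists>a\<in>carrier A. f a = \<delta> x" if "mv_over B D \<delta>" "x \<in> carrier D"
    for D :: "'u mv" and \<delta> x
  proof -
    have "\<delta> x \<in> f ` carrier A"
      using surj that mv_homD(1)[of \<delta> D B x] by (simp add: mv_over_def)
    then show ?thesis by (auto simp: image_iff)
  qed
  have full: "\<exists>g\<in>slice_hom D \<delta> E \<epsilon>.
      \<forall>z\<in>carrier (change_of_base A f D \<delta>). h z = map_prod g id z"
    if D: "mv_over B D \<delta>" and E: "mv_over B E \<epsilon>"
      and h: "h \<in> descent_algebra_hom A f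
              (change_of_base A f D \<delta>) snd (map_prod fst id)
              (change_of_base A f E \<epsilon>) snd (map_prod fst id)"
    for D :: "'u mv" and \<delta> and E :: "'u mv" and \<epsilon> h
  proof -
    let ?D = "mv_pullback D \<delta> A f" and ?E = "mv_pullback E \<epsilon> A f"
    interpret D: mv_algebra D using D by (simp add: mv_over_def)
    have \<delta>: "\<delta> \<in> mv_hom D B" using D by (simp add: mv_over_def)
    note d = mv_homD[OF \<delta>]
    have hh: "h \<in> mv_hom ?D ?E"
      using h by (simp add: descent_algebra_hom_def slice_hom_def change_of_base_def)
    have sndh: "snd (h (x, a)) = a" if "x \<in> carrier D" "a \<in> carrier A" "\<delta> x = f a" for x a
      using h that by (auto simp: descent_algebra_hom_def slice_hom_def change_of_base_def)
    have eq: "fst (h (x, a)) = fst (h (x, a'))"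
      if "x \<in> carrier D" "a \<in> carrier A" "\<delta> x = f a" "a' \<in> carrier A" "\<delta> x = f a'" for x a a'
    proof -
      have "((x, a), a') \<in> carrier (descent_monad A f (change_of_base A f D \<delta>) snd)"
        using that by (simp add: descent_monad_def change_of_base_def)
      then have "h (map_prod fst id ((x, a), a')) = map_prod fst id (map_prod h id ((x, a), a'))"
        using h unfolding descent_algebra_hom_def by blast
      then show ?thesis by simp
    qed
    define s where "s x = (SOME a. a \<in> carrier A \<and> f a = \<delta> x)" for x
    have s: "s x \<in> carrier A" "f (s x) = \<delta> x" if "x \<in> carrier D" for x
      using someI_ex[of "\<lambda>a. a \<in> carrier A \<and> f a = \<delta> x"] lift[OF D that]
      unfolding s_def by auto
    define g where "g x = fst (h (x, s x))" for x
    have g: "h (x, a) = (g x, a)" if "x \<in> carrier D" "a \<in> carrier A" "\<delta> x = f a" for x a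
      using eq[OF that, of "s x"] s[OF that(1)] sndh[OF that]
      by (simp add: g_def prod_eq_iff)
    have gE: "g x \<in> carrier E \<and> \<epsilon> (g x) = \<delta> x" if "x \<in> carrier D" for x
      using mv_homD(1)[OF hh, of "(x, s x)"] g[OF that, of "s x"] s[OF that] that by simp
    have "g \<in> mv_hom D E"
    proof (rule mv_homI)
      show "g x \<in> carrier E" if "x \<in> carrier D" for x using gE that by blast
      show "g (x \<oplus>\<^bsub>D\<^esub> y) = g x \<oplus>\<^bsub>E\<^esub> g y" if "x \<in> carrier D" "y \<in> carrier D" for x y
        using mv_homD(2)[OF hh, of "(x, s x)" "(y, s y)"] that s
        by (simp add: g D.plus_closed A.plus_closed H d)
      show "g (\<^bold>\<not>\<^bsub>D\<^esub> x) = \<^bold>\<not>\<^bsub>E\<^esub> g x" if "x \<in> carrier D" for x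
        using mv_homD(3)[OF hh, of "(x, s x)"] that s
        by (simp add: g D.neg_closed A.neg_closed H d)
      show "g \<zero>\<^bsub>D\<^esub> = \<zero>\<^bsub>E\<^esub>"
        using mv_homD(4)[OF hh] by (simp add: g D.zero_closed A.zero_closed H d)
    qed
    then show ?thesis
      using gE g by (intro bexI[of _ g]) (auto simp: slice_hom_def change_of_base_def)
  qed
  have faithful: "g x = g' x"
    if D: "mv_over B D \<delta>" and x: "x \<in> carrier D"
      and eq: "\<forall>z\<in>carrier (change_of_base A f D \<delta>). map_prod g id z = map_prod g' id z"
    for D :: "'u mv" and \<delta> and g g' :: "'u \<Rightarrow> 'u" and x
  proof -
    obtain a where "a \<in> carrier A" "f a = \<delta> x" using lift[OF D x] by blast
    then show ?thesis using eq[rule_format, of "(x, a)"] x by (simp add: change_of_base_def)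
  qed
  have ess: "\<exists>(D :: 'u mv) \<delta>. mv_over B D \<delta> \<and>
           (\<exists>h\<in>descent_algebra_hom A f
                 (change_of_base A f D \<delta>) snd (map_prod fst id) C \<gamma> \<xi>.
              bij_betw h (carrier (change_of_base A f D \<delta>)) (carrier C))"
    if C: "descent_algebra A f C \<gamma> \<xi>" for C :: "'u mv" and \<gamma> \<xi>
  proof -
    interpret C: mv_algebra C using C by (simp add: descent_algebra_def mv_over_def)
    have \<gamma>: "\<gamma> \<in> mv_hom C A" using C by (simp add: descent_algebra_def mv_over_def)
    note G = mv_homD[OF \<gamma>]
    let ?T = "mv_pullback C (f \<circ> \<gamma>) A f"
    have \<xi>: "\<xi> \<in> mv_hom ?T C"
      using C by (simp add: descent_algebra_def slice_hom_def descent_monad_def change_of_base_def)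
    have x1: "\<xi> (c, a) \<in> carrier C" if "c \<in> carrier C" "a \<in> carrier A" "f (\<gamma> c) = f a" for c a
      using mv_homD(1)[OF \<xi>, of "(c, a)"] that by simp
    have x2: "\<gamma> (\<xi> (c, a)) = a" if "c \<in> carrier C" "a \<in> carrier A" "f (\<gamma> c) = f a" for c a
      using C that
      by (auto simp: descent_algebra_def slice_hom_def descent_monad_def change_of_base_def)
    have x3: "\<xi> (c, \<gamma> c) = c" if "c \<in> carrier C" for c
      using C that by (simp add: descent_algebra_def)
    have x4: "\<xi> (\<xi> (c, a), a') = \<xi> (c, a')"
      if "c \<in> carrier C" "a \<in> carrier A" "f (\<gamma> c) = f a" "a' \<in> carrier A" "f a = f a'" for c a a'
    proof -
      have "((c, a), a') \<in> carrier (descent_monad A f (descent_monad A f C \<gamma>) snd)"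
        using that by (simp add: descent_monad_def change_of_base_def)
      then have "\<xi> (map_prod \<xi> id ((c, a), a')) = \<xi> (map_prod fst id ((c, a), a'))"
        using C unfolding descent_algebra_def by blast
      then show ?thesis by simp
    qed
    define R where "R c c' \<longleftrightarrow> c \<in> carrier C \<and> c' \<in> carrier C \<and> f (\<gamma> c) = f (\<gamma> c') \<and>
      \<xi> (c, \<gamma> c') = c'" for c c'
    have RI: "R c (\<xi> (c, a))" if "c \<in> carrier C" "a \<in> carrier A" "f (\<gamma> c) = f a" for c a
      using that x1 x2 by (simp add: R_def)
    have Rrefl: "R c c" if "c \<in> carrier C" for c using that x3 by (simp add: R_def)
    have Rsym: "R c' c" if "R c c'" for c c'
    proof -
      have "\<xi> (\<xi> (c, \<gamma> c'), \<gamma> c) = \<xi> (c, \<gamma> c)"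
        using that G by (intro x4) (auto simp: R_def)
      then show ?thesis using that x3 by (simp add: R_def)
    qed
    have Rtrans: "R c c''" if "R c c'" "R c' c''" for c c' c''
    proof -
      have "\<xi> (\<xi> (c, \<gamma> c'), \<gamma> c'') = \<xi> (c, \<gamma> c'')"
        using that G by (intro x4) (auto simp: R_def)
      then show ?thesis using that by (simp add: R_def)
    qed
    have Rplus: "R (c \<oplus>\<^bsub>C\<^esub> b) (c' \<oplus>\<^bsub>C\<^esub> b')" if "R c c'" "R b b'" for c b c' b'
      using that mv_homD(2)[OF \<xi>, of "(c, \<gamma> c')" "(b, \<gamma> b')"]
      by (auto simp: R_def C.plus_closed G H)
    have Rneg: "R (\<^bold>\<not>\<^bsub>C\<^esub> c) (\<^bold>\<not>\<^bsub>C\<^esub> c')" if "R c c'" for c c'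
      using that mv_homD(3)[OF \<xi>, of "(c, \<gamma> c')"] by (auto simp: R_def C.neg_closed G H)
    define r where "r c = (SOME c'. R c c')" for c
    have r: "R c (r c)" if "c \<in> carrier C" for c
      unfolding r_def using Rrefl[OF that] by (rule someI)
    have rC: "r c \<in> carrier C" "f (\<gamma> (r c)) = f (\<gamma> c)" if "c \<in> carrier C" for c
      using r[OF that] by (auto simp: R_def)
    have r_eq: "r c = r c'" if "R c c'" for c c'
    proof -
      have "R c = R c'" using that Rsym Rtrans by blast
      then show ?thesis by (simp add: r_def)
    qed
    have rr: "r c = c" if "c \<in> r ` carrier C" for c
      using that r r_eq by force
    define D where "D = \<lparr>carrier = r ` carrier C, mv_plus = (\<lambda>x y. r (x \<oplus>\<^bsub>C\<^esub> y)),
      mv_neg = (\<lambda>x. r (\<^bold>\<not>\<^bsub>C\<^esub> x)), mv_zero = r \<zero>\<^bsub>C\<^esub>\<rparr>"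
    have rD: "r \<in> mv_hom C D"
      by (auto simp: D_def intro!: mv_homI r_eq Rplus Rneg r)
    have D: "mv_algebra D"
      by (rule mv_algebra_image[OF C.mv_algebra_axioms rD]) (simp add: D_def)
    let ?\<delta> = "f \<circ> \<gamma>"
    have "?\<delta> \<in> mv_hom D B"
      by (rule mv_homI) (auto simp: D_def rC G H C.plus_closed C.neg_closed C.zero_closed)
    with D have ov: "mv_over B D ?\<delta>" by (simp add: mv_over_def)
    let ?K = "mv_pullback D ?\<delta> A f"
    have K: "x \<in> carrier C" "a \<in> carrier A" "f (\<gamma> x) = f a" "r x = x" "x \<in> r ` carrier C"
      if "(x, a) \<in> carrier ?K" for x a
    proof -
      show x: "x \<in> r ` carrier C" using that by (simp add: D_def)
      show "x \<in> carrier C" using x rC(1) by blast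
      show "a \<in> carrier A" "f (\<gamma> x) = f a" using that by simp_all
      show "r x = x" using x by (rule rr)
    qed
    have xr: "\<xi> (r c, a) = \<xi> (c, a)" if "c \<in> carrier C" "a \<in> carrier A" "f (\<gamma> c) = f a" for c a
      using x4[OF that(1), of "\<gamma> (r c)" a] r[OF that(1)] that G by (auto simp: R_def)
    have "\<xi> \<in> mv_hom ?K C"
    proof (rule mv_homI)
      show "\<xi> z \<in> carrier C" if "z \<in> carrier ?K" for z
        using that K x1 by (cases z) blast
      show "\<xi> (z \<oplus>\<^bsub>?K\<^esub> z') = \<xi> z \<oplus>\<^bsub>C\<^esub> \<xi> z'" if "z \<in> carrier ?K" "z' \<in> carrier ?K" for z z'
      proof -
        obtain x a y b where z: "z = (x, a)" "z' = (y, b)" by (cases z; cases z')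
        note kx = K[OF that(1)[unfolded z]] and ky = K[OF that(2)[unfolded z]]
        have "\<xi> (z \<oplus>\<^bsub>?K\<^esub> z') = \<xi> (r (x \<oplus>\<^bsub>C\<^esub> y), a \<oplus>\<^bsub>A\<^esub> b)" by (simp add: z D_def)
        also have "\<dots> = \<xi> (x \<oplus>\<^bsub>C\<^esub> y, a \<oplus>\<^bsub>A\<^esub> b)"
          using kx ky by (intro xr) (auto simp: C.plus_closed A.plus_closed G H)
        also have "\<dots> = \<xi> z \<oplus>\<^bsub>C\<^esub> \<xi> z'"
          using mv_homD(2)[OF \<xi>, of "(x, a)" "(y, b)"] kx ky by (simp add: z)
        finally show ?thesis .
      qed
      show "\<xi> (\<^bold>\<not>\<^bsub>?K\<^esub> z) = \<^bold>\<not>\<^bsub>C\<^esub> \<xi> z" if "z \<in> carrier ?K" for z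
      proof -
        obtain x a where z: "z = (x, a)" by (cases z)
        note kx = K[OF that[unfolded z]]
        have "\<xi> (\<^bold>\<not>\<^bsub>?K\<^esub> z) = \<xi> (r (\<^bold>\<not>\<^bsub>C\<^esub> x), \<^bold>\<not>\<^bsub>A\<^esub> a)" by (simp add: z D_def)
        also have "\<dots> = \<xi> (\<^bold>\<not>\<^bsub>C\<^esub> x, \<^bold>\<not>\<^bsub>A\<^esub> a)"
          using kx by (intro xr) (auto simp: C.neg_closed A.neg_closed G H)
        also have "\<dots> = \<^bold>\<not>\<^bsub>C\<^esub> \<xi> z"
          using mv_homD(3)[OF \<xi>, of "(x, a)"] kx by (simp add: z)
        finally show ?thesis .
      qed
      have "\<xi> \<zero>\<^bsub>?K\<^esub> = \<xi> (r \<zero>\<^bsub>C\<^esub>, \<zero>\<^bsub>A\<^esub>)" by (simp add: D_def)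
      also have "\<dots> = \<xi> (\<zero>\<^bsub>C\<^esub>, \<zero>\<^bsub>A\<^esub>)"
        by (intro xr) (auto simp: C.zero_closed A.zero_closed G)
      finally show "\<xi> \<zero>\<^bsub>?K\<^esub> = \<zero>\<^bsub>C\<^esub>" using mv_homD(4)[OF \<xi>] by simp
    qed
    moreover have "\<gamma> (\<xi> z) = snd z" if "z \<in> carrier ?K" for z
      using that x2 K by (cases z) (metis snd_conv)
    moreover have "\<xi> (map_prod fst id z) = \<xi> (map_prod \<xi> id z)"
      if "z \<in> carrier (descent_monad A f ?K snd)" for z
    proof -
      obtain x a a' where z: "z = ((x, a), a')" by (metis prod.exhaust)
      have xa: "(x, a) \<in> carrier ?K" and a': "a' \<in> carrier A" "f a = f a'"
        using that by (simp_all add: z descent_monad_def change_of_base_def)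
      show ?thesis using x4[OF K(1-3)[OF xa] a'] by (simp add: z)
    qed
    ultimately have hom: "\<xi> \<in> descent_algebra_hom A f
        (change_of_base A f D ?\<delta>) snd (map_prod fst id) C \<gamma> \<xi>"
      by (simp add: descent_algebra_hom_def slice_hom_def change_of_base_def)
    have "inj_on \<xi> (carrier ?K)"
    proof (rule inj_onI)
      fix z z' assume zz: "z \<in> carrier ?K" "z' \<in> carrier ?K" "\<xi> z = \<xi> z'"
      obtain x a y b where z: "z = (x, a)" "z' = (y, b)" by (cases z; cases z')
      note kx = K[OF zz(1)[unfolded z]] and ky = K[OF zz(2)[unfolded z]]
      have "a = b" using x2 kx ky zz(3) z by metis
      moreover have "r x = r y"
        using r_eq[OF RI[OF kx(1-3)]] r_eq[OF RI[OF ky(1-3)]] zz(3) by (simp add: z)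
      ultimately show "z = z'" using kx(4) ky(4) by (simp add: z)
    qed
    moreover have "\<xi> ` carrier ?K = carrier C"
    proof
      show "\<xi> ` carrier ?K \<subseteq> carrier C" using K x1 by fast
      show "carrier C \<subseteq> \<xi> ` carrier ?K"
      proof
        fix c assume c: "c \<in> carrier C"
        have "c = \<xi> (r c, \<gamma> c)" using xr[of c "\<gamma> c"] x3 c G by simp
        moreover have "(r c, \<gamma> c) \<in> carrier ?K" using c rC G by (simp add: D_def)
        ultimately show "c \<in> \<xi> ` carrier ?K" by blast
      qed
    qed
    ultimately have "bij_betw \<xi> (carrier (change_of_base A f D ?\<delta>)) (carrier C)"
      by (simp add: bij_betw_def change_of_base_def)
    with ov hom show ?thesis by blast
  qed
  show ?thesis
    unfolding effective_descent_def
  proof (intro conjI allI impI ballI, goal_cases)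
    case 1 show ?case by (rule f)
  next
    case (2 D \<delta> E \<epsilon> h) then show ?case by (elim conjE) (rule full)
  next
    case (3 D \<delta> E \<epsilon> g g' x) then show ?case using faithful[of D \<delta> x g g'] by simp
  next
    case (4 C \<gamma> \<xi>) then show ?case by (rule ess)
  qed
qed

theorem effective_descent_iff_surj:
  fixes A B :: "'u mv"
  assumes "mv_algebra A" "mv_algebra B" "f \<in> mv_hom A B"
  shows "effective_descent A B f \<longleftrightarrow> f ` carrier A = carrier B"
  using effective_descent_imp_surj[OF assms(1,2)] surj_imp_effective_descent[OF assms] by (rule iffI)


section \<open>Trivial and normal extensions\<close>

definition trivial_extension :: "'a mv \<Rightarrow> 'b mv \<Rightarrow> ('a \<Rightarrow> 'b) \<Rightarrow> bool" where
  "trivial_extension A B f \<longleftrightarrow>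
     f \<in> mv_hom A B \<and>
     is_pullback A (S_alg A) B (S_alg B) (eta A) f (S_map B f) (eta B)"

definition kernel_pair :: "'a mv \<Rightarrow> ('a \<Rightarrow> 'b) \<Rightarrow> ('a \<times> 'a) mv" where
  "kernel_pair A f = mv_pullback A f A f"

definition normal_extension :: "'u mv \<Rightarrow> 'u mv \<Rightarrow> ('u \<Rightarrow> 'u) \<Rightarrow> bool" where
  "normal_extension A B f \<longleftrightarrow>
     effective_descent A B f \<and>
     trivial_extension (kernel_pair A f) A fst \<and>
     trivial_extension (kernel_pair A f) A snd"

end

theory Submission
  imports Defs
begin

text \<open>The radical consists of the infinitesimals, i.e. of the \<open>x\<close> with \<open>n x \<le> \<not> x\<close> for all
  \<open>n\<close>. Hence morphisms preserve the radical, and for the kernel pair \<open>K\<close> of \<open>f\<close> one has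
  \<open>Rad K = K \<inter> (Rad A \<times> Rad A)\<close>. A projection of \<open>K\<close> is a trivial extension iff the comparison
  map into the pullback is bijective; it is always surjective, and its injectivity
  means that \<open>Rad A\<close> meets the kernel of \<open>f\<close> only in \<open>0\<close>. If this holds and
  \<open>f\<close> is not injective on \<open>P A\<close>, then \<open>f x = 1\<close> for some infinitesimal \<open>x\<close>, so \<open>1\<close> is
  infinitesimal in \<open>B\<close>. Then \<open>B\<close> is trivial, \<open>f\<close> kills everything, and so \<open>Rad A = {0}\<close>.\<close>

section \<open>Arithmetic in MV-algebras\<close>

context mv_algebra
begin

abbreviation leq :: "'a \<Rightarrow> 'a \<Rightarrow> bool" (infix \<open>\<preceq>\<close> 50) where
  "x \<preceq> y \<equiv> mv_le A x y"

lemma one_closed: "\<one> \<in> carrier A"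
  by (simp add: mv_one_def neg_closed zero_closed)

lemma minus_closed: "\<lbrakk>x \<in> carrier A; y \<in> carrier A\<rbrakk> \<Longrightarrow> x \<ominus> y \<in> carrier A"
  by (simp add: mv_minus_def neg_closed plus_closed)

lemmas closed [simp, intro] = plus_closed neg_closed zero_closed one_closed minus_closed

lemma dist_closed [simp, intro]:
  "\<lbrakk>x \<in> carrier A; y \<in> carrier A\<rbrakk> \<Longrightarrow> mv_dist A x y \<in> carrier A"
  by (simp add: mv_dist_def)

declare plus_zero [simp] neg_neg [simp]

lemma neg_zero [simp]: "\<^bold>\<not> \<zero> = \<one>" by (simp add: mv_one_def)

lemma neg_one [simp]: "\<^bold>\<not> \<one> = \<zero>" by (simp add: mv_one_def del: neg_zero)

lemma plus_one [simp]: "x \<in> carrier A \<Longrightarrow> x \<oplus> \<one> = \<one>"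
  using plus_neg_zero by simp

lemma zero_plus [simp]: "x \<in> carrier A \<Longrightarrow> \<zero> \<oplus> x = x"
  by (simp add: plus_comm[of \<zero>])

lemma one_plus [simp]: "x \<in> carrier A \<Longrightarrow> \<one> \<oplus> x = \<one>"
  by (simp add: plus_comm[of \<one>])

lemma plus_left_comm:
  "\<lbrakk>x \<in> carrier A; y \<in> carrier A; z \<in> carrier A\<rbrakk> \<Longrightarrow> x \<oplus> (y \<oplus> z) = y \<oplus> (x \<oplus> z)"
  using plus_assoc[of x y z] plus_assoc[of y x z] plus_comm[of x y] by simp

lemmas plus_ac = plus_assoc plus_comm plus_left_comm

text \<open>At y = 1 one side of the Lukasiewicz axiom collapses to 1 and the other to \<not> x
  \<oplus> x.\<close>

lemma neg_plus_self [simp]: "x \<in> carrier A \<Longrightarrow> \<^bold>\<not> x \<oplus> x = \<one>"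
  using lukasiewicz[of x \<one>] by simp

lemma plus_neg_self [simp]: "x \<in> carrier A \<Longrightarrow> x \<oplus> \<^bold>\<not> x = \<one>"
  by (simp add: plus_comm[of x])

lemma minus_self [simp]: "x \<in> carrier A \<Longrightarrow> x \<ominus> x = \<zero>"
  by (simp add: mv_minus_def)

lemma neg_minus: "\<lbrakk>x \<in> carrier A; y \<in> carrier A\<rbrakk> \<Longrightarrow> \<^bold>\<not> (x \<ominus> y) = \<^bold>\<not> x \<oplus> y"
  by (simp add: mv_minus_def)

lemma neg_minus_neg: "\<lbrakk>x \<in> carrier A; y \<in> carrier A\<rbrakk> \<Longrightarrow> \<^bold>\<not> x \<ominus> \<^bold>\<not> y = y \<ominus> x"
  by (simp add: mv_minus_def plus_comm)

section \<open>The natural order, joins and meets\<close>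

lemma le_refl [simp]: "x \<in> carrier A \<Longrightarrow> x \<preceq> x"
  by (simp add: mv_le_def)

lemma zero_le [simp]: "x \<in> carrier A \<Longrightarrow> \<zero> \<preceq> x"
  by (simp add: mv_le_def)

lemma le_one [simp]: "x \<in> carrier A \<Longrightarrow> x \<preceq> \<one>"
  by (simp add: mv_le_def)

lemma le_plus1: "\<lbrakk>x \<in> carrier A; y \<in> carrier A\<rbrakk> \<Longrightarrow> x \<preceq> x \<oplus> y"
  by (simp add: mv_le_def plus_assoc[symmetric])

lemma le_plus2: "\<lbrakk>x \<in> carrier A; y \<in> carrier A\<rbrakk> \<Longrightarrow> x \<preceq> y \<oplus> x"
  using le_plus1 by (simp add: plus_comm)

text \<open>The Lukasiewicz axiom in disguise: \<open>(x \<ominus> y) \<oplus> y\<close> is the join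
  of \<open>x\<close> and \<open>y\<close>, so it is symmetric.\<close>

lemma join_comm:
  "\<lbrakk>x \<in> carrier A; y \<in> carrier A\<rbrakk> \<Longrightarrow> (x \<ominus> y) \<oplus> y = (y \<ominus> x) \<oplus> x"
  by (simp add: mv_minus_def lukasiewicz)

lemma le_iff_minus: "\<lbrakk>x \<in> carrier A; y \<in> carrier A\<rbrakk> \<Longrightarrow> x \<preceq> y \<longleftrightarrow> x \<ominus> y = \<zero>"
  unfolding mv_le_def mv_minus_def by (auto dest: arg_cong[of _ _ "mv_neg A"])

text \<open>If \<open>x\<close> is below \<open>y\<close>, then \<open>x \<ominus> y\<close>
  vanishes and one side of \<open>join_comm\<close> reduces to \<open>y\<close>. Inequalities
  thereby become equations, which gives transitivity and monotonicity.\<close>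

lemma le_imp_eq_plus:
  assumes "x \<in> carrier A" "y \<in> carrier A" "x \<preceq> y"
  shows "y = x \<oplus> (y \<ominus> x)"
  using join_comm[of x y] assms by (simp add: le_iff_minus plus_comm)

lemma le_antisym:
  assumes "x \<in> carrier A" "y \<in> carrier A" "x \<preceq> y" "y \<preceq> x"
  shows "x = y"
  using join_comm[of x y] assms by (simp add: le_iff_minus)

lemma le_trans:
  assumes "x \<in> carrier A" "y \<in> carrier A" "z \<in> carrier A" "x \<preceq> y" "y \<preceq> z"
  shows "x \<preceq> z"
proof -
  have "z = y \<oplus> (z \<ominus> y)" "y = x \<oplus> (y \<ominus> x)"
    using assms le_imp_eq_plus by auto
  then have "z = x \<oplus> ((y \<ominus> x) \<oplus> (z \<ominus> y))"
    using assms by (metis closed(5) plus_assoc)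
  then show ?thesis
    using assms le_plus1[of x "(y \<ominus> x) \<oplus> (z \<ominus> y)"] by simp
qed

lemma plus_mono:
  assumes "x \<in> carrier A" "y \<in> carrier A" "x' \<in> carrier A" "y' \<in> carrier A"
    and "x \<preceq> x'" "y \<preceq> y'"
  shows "x \<oplus> y \<preceq> x' \<oplus> y'"
proof -
  have "x' \<oplus> y' = (x \<oplus> (x' \<ominus> x)) \<oplus> (y \<oplus> (y' \<ominus> y))"
    using assms le_imp_eq_plus by metis
  also have "\<dots> = (x \<oplus> y) \<oplus> ((x' \<ominus> x) \<oplus> (y' \<ominus> y))"
    using assms by (simp add: plus_ac)
  finally show ?thesis using assms le_plus1[of "x \<oplus> y" "(x' \<ominus> x) \<oplus> (y' \<ominus> y)"] by simp
qed

text \<open>Both inequalities unfold to \<not> x \<oplus> y \<oplus> z = 1. Subtracting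
  \<open>y\<close> is thus left adjoint to adding \<open>y\<close>, and most estimates below are
  instances of this.\<close>

lemma residuation:
  "\<lbrakk>x \<in> carrier A; y \<in> carrier A; z \<in> carrier A\<rbrakk> \<Longrightarrow> x \<ominus> y \<preceq> z \<longleftrightarrow> x \<preceq> y \<oplus> z"
  by (simp add: mv_le_def neg_minus plus_assoc)

lemma le_plus_minus: "\<lbrakk>x \<in> carrier A; y \<in> carrier A\<rbrakk> \<Longrightarrow> x \<preceq> y \<oplus> (x \<ominus> y)"
  using residuation[of x y "x \<ominus> y"] by simp

lemma minus_le: "\<lbrakk>x \<in> carrier A; y \<in> carrier A\<rbrakk> \<Longrightarrow> x \<ominus> y \<preceq> x"
  by (simp add: residuation le_plus2)

lemma minus_le_neg: "\<lbrakk>x \<in> carrier A; y \<in> carrier A\<rbrakk> \<Longrightarrow> x \<ominus> y \<preceq> \<^bold>\<not> y"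
  by (simp add: residuation)

lemma neg_antimono:
  "\<lbrakk>x \<in> carrier A; y \<in> carrier A; x \<preceq> y\<rbrakk> \<Longrightarrow> \<^bold>\<not> y \<preceq> \<^bold>\<not> x"
  by (simp add: mv_le_def plus_comm)

lemma meet_le2: "\<lbrakk>x \<in> carrier A; y \<in> carrier A\<rbrakk> \<Longrightarrow> x \<ominus> (x \<ominus> y) \<preceq> y"
  using le_plus_minus[of x y] by (simp add: residuation plus_comm)

text \<open>The bound on \<open>u\<close> says that the sum \<open>x \<oplus> u\<close> is not
  truncated. Negating the left side produces the join of \<not> x and \<open>u\<close>, which is
  \<not> x by this bound.\<close>

lemma plus_minus_cancel:
  assumes "x \<in> carrier A" "u \<in> carrier A" "u \<preceq> \<^bold>\<not> x"
  shows "(x \<oplus> u) \<ominus> u = x"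
proof -
  have "\<^bold>\<not> ((x \<oplus> u) \<ominus> u) = (\<^bold>\<not> x \<ominus> u) \<oplus> u"
    using assms by (simp add: neg_minus) (simp add: mv_minus_def)
  also have "\<dots> = \<^bold>\<not> x"
    using assms le_imp_eq_plus[of u "\<^bold>\<not> x"] by (simp add: plus_comm)
  finally have "\<^bold>\<not> (\<^bold>\<not> ((x \<oplus> u) \<ominus> u)) = \<^bold>\<not> (\<^bold>\<not> x)" by simp
  then show ?thesis using assms by simp
qed

text \<open>The join of \<open>x\<close> and \<open>y\<close> is also
  \<open>y \<oplus> (x \<ominus> y)\<close>, an untruncated sum, so \<open>x \<ominus> y\<close> can
  be cancelled. This is the translation carrying \<open>x\<close> to \<open>y\<close> that is reused
  in \<open>shift_mod_Rad\<close>.\<close>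

lemma join_minus_minus:
  assumes "x \<in> carrier A" "y \<in> carrier A"
  shows "(x \<oplus> (y \<ominus> x)) \<ominus> (x \<ominus> y) = y"
proof -
  have "x \<oplus> (y \<ominus> x) = y \<oplus> (x \<ominus> y)"
    using join_comm[of x y] assms by (simp add: plus_comm)
  then show ?thesis
    using assms by (simp add: plus_minus_cancel minus_le_neg)
qed

lemma minus_antimono:
  assumes c: "x \<in> carrier A" "y \<in> carrier A" "t \<in> carrier A" and t: "t \<preceq> y"
  shows "x \<ominus> y \<preceq> x \<ominus> t"
proof -
  have "x \<preceq> t \<oplus> (x \<ominus> t)" using c by (simp add: le_plus_minus)
  moreover have "t \<oplus> (x \<ominus> t) \<preceq> y \<oplus> (x \<ominus> t)" using c t by (intro plus_mono) auto
  ultimately have "x \<preceq> y \<oplus> (x \<ominus> t)"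
    using c le_trans[of x "t \<oplus> (x \<ominus> t)" "y \<oplus> (x \<ominus> t)"] by simp
  then show ?thesis using c by (simp add: residuation)
qed

text \<open>The De Morgan dual of \<open>join_comm\<close>:
  \<open>x \<ominus> (x \<ominus> y)\<close> is the meet of \<open>x\<close> and
  \<open>y\<close>.\<close>

lemma meet_comm:
  assumes c: "x \<in> carrier A" "y \<in> carrier A"
  shows "x \<ominus> (x \<ominus> y) = y \<ominus> (y \<ominus> x)"
proof -
  have *: "a \<ominus> (a \<ominus> b) = \<^bold>\<not> (\<^bold>\<not> (b \<oplus> \<^bold>\<not> a) \<oplus> \<^bold>\<not> a)" if "a \<in> carrier A" "b \<in> carrier A" for a b
    using that plus_comm[of "\<^bold>\<not> a" b] plus_comm[of "\<^bold>\<not> a" "\<^bold>\<not> (b \<oplus> \<^bold>\<not> a)"]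
    by (simp add: mv_minus_def)
  show ?thesis using c lukasiewicz[of "\<^bold>\<not> y" "\<^bold>\<not> x"] by (simp add: *)
qed

lemma le_meet:
  assumes c: "x \<in> carrier A" "y \<in> carrier A" "t \<in> carrier A" and t: "t \<preceq> x" "t \<preceq> y"
  shows "t \<preceq> x \<ominus> (x \<ominus> y)"
proof -
  \<comment> \<open>\<open>t\<close> is its own meet with \<open>x\<close>, and two uses of
    antitonicity make the meet with \<open>x\<close> monotone.\<close>
  have "x \<ominus> (x \<ominus> t) = t"
    using c t by (subst meet_comm) (simp_all add: le_iff_minus[of t x] mv_minus_def[of A t \<zero>])
  then show ?thesis
    using c t minus_antimono[of x "x \<ominus> t" "x \<ominus> y"] by (simp add: minus_antimono)
qed

text \<open>The two one-sided differences are what remains of \<open>x\<close> and \<open>y\<close>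
  once their meet \<open>w\<close> is split off. A common lower bound \<open>z\<close> of them makes
  \<open>z \<oplus> w\<close> a lower bound of \<open>x\<close> and \<open>y\<close>, hence equal to
  \<open>w\<close>, and cancelling \<open>w\<close> leaves zero.\<close>

lemma prelinear:
  assumes c: "x \<in> carrier A" "y \<in> carrier A" "z \<in> carrier A"
    and z: "z \<preceq> x \<ominus> y" "z \<preceq> y \<ominus> x"
  shows "z = \<zero>"
proof -
  define w where "w = x \<ominus> (x \<ominus> y)"
  have w: "w \<in> carrier A" using c by (simp add: w_def)
  have xy: "x \<ominus> y \<preceq> \<^bold>\<not> w"
    using c by (simp add: w_def neg_minus le_plus2)
  have x: "x = (x \<ominus> y) \<oplus> w"
    using c le_imp_eq_plus[of "x \<ominus> y" x] by (simp add: w_def minus_le)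
  have w': "w = y \<ominus> (y \<ominus> x)" using c by (simp add: w_def meet_comm)
  have y: "y = (y \<ominus> x) \<oplus> w"
    using c le_imp_eq_plus[of "y \<ominus> x" y] by (simp add: w' minus_le)
  have "z \<oplus> w \<preceq> x" "z \<oplus> w \<preceq> y"
    using c w z plus_mono[of z w "x \<ominus> y" w] plus_mono[of z w "y \<ominus> x" w] x y by simp_all
  then have "z \<oplus> w \<preceq> w" using c w by (simp add: w_def le_meet)
  then have "z \<oplus> w = w" using c w by (intro le_antisym) (auto simp: le_plus2)
  \<comment> \<open>This makes the sum \<open>z \<oplus> w\<close> untruncated, as
    \<open>plus_minus_cancel\<close> requires.\<close>
  moreover have "w \<preceq> \<^bold>\<not> z"
  proof -
    have "z \<preceq> \<^bold>\<not> w" using c w z xy le_trans[of z "x \<ominus> y" "\<^bold>\<not> w"] by simp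
    then show ?thesis using c w neg_antimono[of z "\<^bold>\<not> w"] by simp
  qed
  ultimately show ?thesis using plus_minus_cancel[of z w] c w by simp
qed

section \<open>Multiples of an element and disjointness\<close>

primrec mult :: "nat \<Rightarrow> 'a \<Rightarrow> 'a" where
  "mult 0 x = \<zero>"
| "mult (Suc n) x = x \<oplus> mult n x"

lemma mult_closed [simp, intro]: "x \<in> carrier A \<Longrightarrow> mult n x \<in> carrier A"
  by (induction n) auto

lemma mult_add: "x \<in> carrier A \<Longrightarrow> mult (m + n) x = mult m x \<oplus> mult n x"
  by (induction m) (auto simp: plus_assoc)

text \<open>Disjointness from \<open>z\<close> passes to its multiples. In the induction step the
  meet of \<open>t\<close> and \<open>z\<close> is zero, so \<open>t\<close> is below
  \<open>t \<ominus> z\<close>, which removes one summand \<open>z\<close> from the bound.\<close>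

lemma disjoint_mult:
  assumes c: "a \<in> carrier A" "z \<in> carrier A"
    and disj: "\<And>t. \<lbrakk>t \<in> carrier A; t \<preceq> a; t \<preceq> z\<rbrakk> \<Longrightarrow> t = \<zero>"
    and t: "t \<in> carrier A" "t \<preceq> a" "t \<preceq> mult n z"
  shows "t = \<zero>"
  using t
proof (induction n)
  case 0
  then show ?case using le_antisym[of t \<zero>] by simp
next
  case (Suc n)
  have "t \<ominus> (t \<ominus> z) = \<zero>"
  proof (rule disj)
    show "t \<ominus> (t \<ominus> z) \<preceq> a"
      using Suc.prems c minus_le[of t "t \<ominus> z"] le_trans[of "t \<ominus> (t \<ominus> z)" t a] by simp
  qed (use Suc.prems c in \<open>auto simp: meet_le2\<close>)
  then have "t \<preceq> t \<ominus> z" using Suc.prems c by (simp add: le_iff_minus)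
  moreover have "t \<ominus> z \<preceq> mult n z" using Suc.prems c by (simp add: residuation)
  ultimately have "t \<preceq> mult n z"
    using Suc.prems c le_trans[of t "t \<ominus> z" "mult n z"] by simp
  then show ?case using Suc by blast
qed

section \<open>Ideals and the radical\<close>

lemma idealD:
  assumes "mv_ideal A I"
  shows "x \<in> I \<Longrightarrow> x \<in> carrier A" "\<zero> \<in> I" "\<lbrakk>x \<in> I; y \<in> I\<rbrakk> \<Longrightarrow> x \<oplus> y \<in> I"
    "\<lbrakk>x \<in> I; y \<in> carrier A; y \<preceq> x\<rbrakk> \<Longrightarrow> y \<in> I"
  using assms unfolding mv_ideal_def by blast+

lemma ideal_proper_iff:
  assumes "mv_ideal A I" shows "I \<noteq> carrier A \<longleftrightarrow> \<one> \<notin> I"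
  using idealD[OF assms] by (metis closed(4) le_one subsetI subset_antisym)

lemma ideal_mult: "\<lbrakk>mv_ideal A I; x \<in> I\<rbrakk> \<Longrightarrow> mult n x \<in> I"
  by (induction n) (auto intro: idealD)

lemma zero_ideal: "mv_ideal A {\<zero>}"
proof -
  have "y = \<zero>" if "y \<in> carrier A" "y \<preceq> \<zero>" for y
    using that le_antisym[of y \<zero>] by simp
  then show ?thesis by (simp add: mv_ideal_def)
qed

text \<open>This is the ideal generated by \<open>I\<close> and \<open>x\<close>. It yields
  principal ideals for \<open>I\<close> the zero ideal, and it tests maximality when
  \<open>I\<close> is maximal.\<close>

lemma ideal_adjoin:
  assumes I: "mv_ideal A I" and x: "x \<in> carrier A"
  shows "mv_ideal A {y \<in> carrier A. \<exists>m\<in>I. \<exists>n. y \<preceq> m \<oplus> mult n x}"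
  unfolding mv_ideal_def
proof (intro conjI ballI impI)
  show "\<zero> \<in> {y \<in> carrier A. \<exists>m\<in>I. \<exists>n. y \<preceq> m \<oplus> mult n x}"
    using idealD(2)[OF I] x by (auto intro!: bexI[of _ \<zero>])
next
  fix y y' assume y: "y \<in> {y \<in> carrier A. \<exists>m\<in>I. \<exists>n. y \<preceq> m \<oplus> mult n x}"
    and y': "y' \<in> {y \<in> carrier A. \<exists>m\<in>I. \<exists>n. y \<preceq> m \<oplus> mult n x}"
  then obtain m n m' n' where m: "m \<in> I" "y \<preceq> m \<oplus> mult n x" "m' \<in> I" "y' \<preceq> m' \<oplus> mult n' x"
    by blast
  note mc = idealD(1)[OF I m(1)] idealD(1)[OF I m(3)]
  have "y \<oplus> y' \<preceq> (m \<oplus> mult n x) \<oplus> (m' \<oplus> mult n' x)"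
    using y y' m mc x by (intro plus_mono) auto
  also have "(m \<oplus> mult n x) \<oplus> (m' \<oplus> mult n' x) = (m \<oplus> m') \<oplus> mult (n + n') x"
    using mc x by (simp add: mult_add plus_ac)
  finally show "y \<oplus> y' \<in> {y \<in> carrier A. \<exists>m\<in>I. \<exists>n. y \<preceq> m \<oplus> mult n x}"
    using y y' idealD(3)[OF I m(1,3)] by blast
next
  fix y y' assume y: "y \<in> {y \<in> carrier A. \<exists>m\<in>I. \<exists>n. y \<preceq> m \<oplus> mult n x}"
    and y': "y' \<in> carrier A" "y' \<preceq> y"
  then obtain m n where m: "y \<in> carrier A" "m \<in> I" "y \<preceq> m \<oplus> mult n x" by blast
  have "y' \<preceq> m \<oplus> mult n x"
    using y' m idealD(1)[OF I m(2)] x le_trans[of y' y "m \<oplus> mult n x"] by simp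
  with m(2) y'(1) show "y' \<in> {y \<in> carrier A. \<exists>m\<in>I. \<exists>n. y \<preceq> m \<oplus> mult n x}" by blast
qed auto

lemma maximal_ideal_exists:
  assumes I: "mv_ideal A I" "\<one> \<notin> I"
  shows "\<exists>M. maximal_mv_ideal A M \<and> I \<subseteq> M"
proof -
  \<comment> \<open>Properness is expressed as avoiding 1, a condition that visibly survives unions
    of chains.\<close>
  let ?F = "{J. mv_ideal A J \<and> I \<subseteq> J \<and> \<one> \<notin> J}"
  have "\<exists>M\<in>?F. \<forall>X\<in>?F. M \<subseteq> X \<longrightarrow> X = M"
  proof (rule subset_Zorn_nonempty)
    show "?F \<noteq> {}" using I by blast
    fix C assume C: "C \<noteq> {}" "subset.chain ?F C"
    have CF: "C \<subseteq> ?F" and lin: "\<And>X Y. X \<in> C \<Longrightarrow> Y \<in> C \<Longrightarrow> X \<subseteq> Y \<or> Y \<subseteq> X"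
      using C(2) by (auto simp: subset_chain_def)
    have CI: "mv_ideal A X" if "X \<in> C" for X using CF that by blast
    have "mv_ideal A (\<Union>C)"
      unfolding mv_ideal_def
    proof (intro conjI ballI impI)
      show "\<Union>C \<subseteq> carrier A" using idealD(1)[OF CI] by blast
      show "\<zero> \<in> \<Union>C" using C(1) idealD(2)[OF CI] by blast
      show "x \<oplus> y \<in> \<Union>C" if xy: "x \<in> \<Union>C" "y \<in> \<Union>C" for x y
      proof -
        obtain X where "X \<in> C" "x \<in> X" using xy(1) by blast
        moreover obtain Y where "Y \<in> C" "y \<in> Y" using xy(2) by blast
        ultimately obtain Z where "Z \<in> C" "x \<in> Z" "y \<in> Z" using lin by blast
        then show ?thesis using idealD(3)[OF CI] by blast
      qed
      show "y \<in> \<Union>C" if y: "x \<in> \<Union>C" "y \<in> carrier A" "y \<preceq> x" for x y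
      proof -
        obtain X where "X \<in> C" "x \<in> X" using y(1) by blast
        then show ?thesis using idealD(4)[OF CI _ y(2,3)] by blast
      qed
    qed
    moreover have "I \<subseteq> \<Union>C" using C(1) CF by fast
    moreover have "\<one> \<notin> \<Union>C" using CF by fast
    ultimately show "\<Union>C \<in> ?F" by simp
  qed
  then obtain M where M: "M \<in> ?F" "\<forall>X\<in>?F. M \<subseteq> X \<longrightarrow> X = M" by (elim bexE)
  have "J = M" if J: "mv_ideal A J" "M \<subseteq> J" "J \<noteq> carrier A" for J
  proof -
    have "J \<in> ?F" using M(1) J(1,2) ideal_proper_iff[OF J(1)] J(3) by auto
    then show ?thesis using M(2) J(2) by simp
  qed
  then show ?thesis
    using M(1) ideal_proper_iff[of M] unfolding maximal_mv_ideal_def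
    by (intro exI[of _ M]) simp
qed

lemma Rad_ideal: "mv_ideal A (Rad A)"
proof -
  have "mv_ideal A M" if "maximal_mv_ideal A M" for M
    using that by (simp add: maximal_mv_ideal_def)
  note D = idealD(2-4)[OF this]
  show ?thesis
    unfolding mv_ideal_def Rad_def using D by (simp add: subset_iff) blast
qed

text \<open>For the inclusion of the radical in the set of infinitesimals: if \<open>n x \<preceq> \<^bold>\<not> x\<close> fails,
  then by prelinearity the ideal generated by \<open>\<^bold>\<not> x \<ominus> n x = \<^bold>\<not> ((n + 1) x)\<close> is proper,
  and a maximal ideal above it cannot contain \<open>x\<close>.\<close>

lemma Rad_iff:
  "x \<in> Rad A \<longleftrightarrow> x \<in> carrier A \<and> (\<forall>n. mult n x \<preceq> \<^bold>\<not> x)"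
proof (intro iffI conjI allI)
  assume x: "x \<in> Rad A"
  then show xA: "x \<in> carrier A" by (simp add: Rad_def)
  fix n
  let ?a = "mult n x \<ominus> \<^bold>\<not> x" and ?z = "\<^bold>\<not> x \<ominus> mult n x"
  let ?I = "{y \<in> carrier A. \<exists>m\<in>{\<zero>}. \<exists>n. y \<preceq> m \<oplus> mult n ?z}"
  show "mult n x \<preceq> \<^bold>\<not> x"
  proof (rule ccontr)
    assume neg: "\<not> mult n x \<preceq> \<^bold>\<not> x"
    then have a: "?a \<noteq> \<zero>" using xA by (simp add: le_iff_minus)
    \<comment> \<open>If 1 were below a multiple of \<open>?z\<close>, then so would be
      \<open>?a\<close>. Prelinearity makes \<open>?a\<close> and \<open>?z\<close> disjoint, and
      \<open>disjoint_mult\<close> would force \<open>?a\<close> to be zero.\<close>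
    have one: "\<one> \<notin> ?I"
    proof
      assume "\<one> \<in> ?I"
      then obtain k where "\<one> \<preceq> mult k ?z" using xA by auto
      then have "?a \<preceq> mult k ?z" using xA le_trans[of ?a \<one> "mult k ?z"] by simp
      then have "?a = \<zero>"
        using xA disjoint_mult[of ?a ?z ?a k] prelinear[of "mult n x" "\<^bold>\<not> x"] by simp
      with a show False by contradiction
    qed
    have I: "mv_ideal A ?I" by (rule ideal_adjoin[OF zero_ideal]) (use xA in auto)
    obtain M where M: "maximal_mv_ideal A M" "?I \<subseteq> M"
      using maximal_ideal_exists[OF I one] by blast
    then have MI: "mv_ideal A M" and M1: "\<one> \<notin> M"
      using ideal_proper_iff by (auto simp: maximal_mv_ideal_def)
    have "?z \<preceq> \<zero> \<oplus> mult 1 ?z" using xA by simp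
    then have "?z \<in> ?I" using xA by blast
    then have z: "?z \<in> M" using M by blast
    have xM: "x \<in> M" using x M by (simp add: Rad_def)
    have "mult (Suc n) x \<oplus> ?z \<in> M"
      using idealD(3)[OF MI] ideal_mult[OF MI xM] z by blast
    moreover have "mult (Suc n) x \<oplus> ?z = \<one>"
    proof -
      have "\<^bold>\<not> ?z = mult (Suc n) x" using xA by (simp add: neg_minus)
      then show ?thesis using xA neg_plus_self[of ?z] by simp
    qed
    ultimately show False using M1 by simp
  qed
next
  assume x: "x \<in> carrier A \<and> (\<forall>n. mult n x \<preceq> \<^bold>\<not> x)"
  then have xA: "x \<in> carrier A" by simp
  have "x \<in> M" if M: "maximal_mv_ideal A M" for M
  proof (rule ccontr)
    assume nx: "x \<notin> M"
    \<comment> \<open>\<open>J\<close> is generated by \<open>M\<close> and \<open>x\<close>, so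
      maximality makes it the whole algebra and it contains 1.\<close>
    define J where "J = {y \<in> carrier A. \<exists>m\<in>M. \<exists>n. y \<preceq> m \<oplus> mult n x}"
    have MI: "mv_ideal A M" and max: "\<forall>J. mv_ideal A J \<and> M \<subseteq> J \<and> J \<noteq> carrier A \<longrightarrow> J = M"
      using M by (simp_all add: maximal_mv_ideal_def)
    have JI: "mv_ideal A J" unfolding J_def by (rule ideal_adjoin[OF MI xA])
    have "M \<subseteq> J"
    proof
      fix m assume m: "m \<in> M"
      then have mA: "m \<in> carrier A" by (rule idealD(1)[OF MI])
      then have "m \<preceq> m \<oplus> mult 0 x" by simp
      then show "m \<in> J" unfolding J_def using m mA by blast
    qed
    moreover have "x \<in> J"
    proof -
      have "x \<preceq> \<zero> \<oplus> mult 1 x" using xA by simp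
      then show ?thesis unfolding J_def using xA idealD(2)[OF MI] by blast
    qed
    ultimately have "J = carrier A" using JI nx max by metis
    then have "\<one> \<in> J" by simp
    then obtain m n where m: "m \<in> M" "\<one> \<preceq> m \<oplus> mult n x" unfolding J_def by blast
    have mA: "m \<in> carrier A" by (rule idealD(1)[OF MI m(1)])
    \<comment> \<open>Infinitesimality of \<open>x\<close> continues this to \<not> m \<le> \<not>
      x, so \<open>x\<close> lies below \<open>m\<close> and hence in \<open>M\<close> after
      all.\<close>
    have "\<^bold>\<not> m \<preceq> mult n x"
      using m(2) mA xA residuation[of \<one> m "mult n x"] by (simp add: mv_minus_def)
    then have "\<^bold>\<not> m \<preceq> \<^bold>\<not> x" using x mA le_trans[of "\<^bold>\<not> m" "mult n x" "\<^bold>\<not> x"] by simp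
    then have "x \<preceq> m" using xA mA neg_antimono[of "\<^bold>\<not> m" "\<^bold>\<not> x"] by simp
    then show False using nx idealD(4)[OF MI m(1) xA] by simp
  qed
  then show "x \<in> Rad A" using xA by (simp add: Rad_def)
qed

section \<open>The congruence of an ideal and the quotient by the radical\<close>

lemma dist_in_ideal_iff:
  assumes I: "mv_ideal A I" and c: "x \<in> carrier A" "y \<in> carrier A"
  shows "mv_dist A x y \<in> I \<longleftrightarrow> x \<ominus> y \<in> I \<and> y \<ominus> x \<in> I"
proof
  assume "mv_dist A x y \<in> I"
  from idealD(4)[OF I this] show "x \<ominus> y \<in> I \<and> y \<ominus> x \<in> I"
    using c by (simp add: mv_dist_def le_plus1 le_plus2)
next
  assume "x \<ominus> y \<in> I \<and> y \<ominus> x \<in> I"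
  then show "mv_dist A x y \<in> I" by (simp add: mv_dist_def idealD(3)[OF I])
qed

lemma dist_eq_zero_iff:
  assumes "x \<in> carrier A" "y \<in> carrier A"
  shows "mv_dist A x y = \<zero> \<longleftrightarrow> x = y"
  using dist_in_ideal_iff[OF zero_ideal assms] assms le_antisym[of x y]
  by (auto simp: le_iff_minus)

lemma ideal_cong_iff:
  assumes "mv_ideal A I"
  shows "(x, y) \<in> ideal_cong A I \<longleftrightarrow>
    x \<in> carrier A \<and> y \<in> carrier A \<and> x \<ominus> y \<in> I \<and> y \<ominus> x \<in> I"
  using dist_in_ideal_iff[OF assms] by (auto simp: ideal_cong_def)

text \<open>A one-sided triangle inequality, from which transitivity of the ideal congruence
  follows.\<close>

lemma minus_triangle:
  assumes c: "x \<in> carrier A" "y \<in> carrier A" "z \<in> carrier A"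
  shows "x \<ominus> z \<preceq> (y \<ominus> z) \<oplus> (x \<ominus> y)"
proof -
  have "x \<preceq> y \<oplus> (x \<ominus> y)" using c by (simp add: le_plus_minus)
  moreover have "y \<oplus> (x \<ominus> y) \<preceq> (z \<oplus> (y \<ominus> z)) \<oplus> (x \<ominus> y)"
    using c by (intro plus_mono) (auto simp: le_plus_minus)
  ultimately have "x \<preceq> (z \<oplus> (y \<ominus> z)) \<oplus> (x \<ominus> y)"
    using c le_trans[of x "y \<oplus> (x \<ominus> y)" "(z \<oplus> (y \<ominus> z)) \<oplus> (x \<ominus> y)"] by simp
  then show ?thesis using c by (simp add: residuation plus_assoc)
qed

lemma plus_minus_plus:
  assumes c: "x \<in> carrier A" "y \<in> carrier A" "x' \<in> carrier A" "y' \<in> carrier A"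
  shows "(x \<oplus> x') \<ominus> (y \<oplus> y') \<preceq> (x \<ominus> y) \<oplus> (x' \<ominus> y')"
proof -
  have "x \<oplus> x' \<preceq> (y \<oplus> (x \<ominus> y)) \<oplus> (y' \<oplus> (x' \<ominus> y'))"
    using c by (intro plus_mono) (auto simp: le_plus_minus)
  then show ?thesis using c by (simp add: residuation plus_ac)
qed

lemma equiv_ideal_cong:
  assumes I: "mv_ideal A I" shows "equiv (carrier A) (ideal_cong A I)"
proof (rule equivI)
  show "ideal_cong A I \<subseteq> carrier A \<times> carrier A" by (auto simp: ideal_cong_def)
  show "refl_on (carrier A) (ideal_cong A I)"
    using idealD(2)[OF I] by (auto simp: refl_on_def ideal_cong_iff[OF I])
  show "sym (ideal_cong A I)" by (auto simp: sym_def ideal_cong_iff[OF I])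
  show "trans (ideal_cong A I)"
  proof (rule transI)
    have *: "x \<ominus> z \<in> I" if "x \<in> carrier A" "y \<in> carrier A" "z \<in> carrier A" "x \<ominus> y \<in> I" "y \<ominus> z \<in> I"
      for x y z
      using that idealD(4)[OF I idealD(3)[OF I that(5,4)]] by (simp add: minus_triangle)
    show "(x, z) \<in> ideal_cong A I"
      if "(x, y) \<in> ideal_cong A I" "(y, z) \<in> ideal_cong A I" for x y z
      using that *[of x y z] *[of z y x] by (simp add: ideal_cong_iff[OF I])
  qed
qed

lemma ideal_cong_plus:
  assumes I: "mv_ideal A I" and "(x, y) \<in> ideal_cong A I" "(x', y') \<in> ideal_cong A I"
  shows "(x \<oplus> x', y \<oplus> y') \<in> ideal_cong A I"
proof -
  have "(x \<oplus> x') \<ominus> (y \<oplus> y') \<in> I"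
    if "x \<in> carrier A" "y \<in> carrier A" "x' \<in> carrier A" "y' \<in> carrier A" "x \<ominus> y \<in> I" "x' \<ominus> y' \<in> I"
    for x y x' y'
    using that idealD(4)[OF I idealD(3)[OF I that(5,6)]] by (simp add: plus_minus_plus)
  then show ?thesis using assms(2,3) unfolding ideal_cong_iff[OF I] by simp
qed

lemma ideal_cong_neg:
  assumes I: "mv_ideal A I" and "(x, y) \<in> ideal_cong A I"
  shows "(\<^bold>\<not> x, \<^bold>\<not> y) \<in> ideal_cong A I"
  using assms(2) by (auto simp: ideal_cong_iff[OF I] neg_minus_neg)

lemma eta_eq_iff:
  assumes "x \<in> carrier A" "y \<in> carrier A"
  shows "eta A x = eta A y \<longleftrightarrow> mv_dist A x y \<in> Rad A"
  unfolding eta_def using eq_equiv_class_iff[OF equiv_ideal_cong[OF Rad_ideal] assms] assms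
  by (simp add: ideal_cong_def)

text \<open>Quotient operations and \<open>S_map\<close> are encoded as unions over representatives.
  The class contains \<open>x\<close>, so it is nonempty, and a union of equal sets over it is their
  common value.\<close>

lemma UN_eta_eq:
  assumes "x \<in> carrier A" "\<And>x'. (x, x') \<in> ideal_cong A (Rad A) \<Longrightarrow> g x' = g x"
  shows "(\<Union>x'\<in>eta A x. g x') = g x"
proof -
  have "x \<in> eta A x"
    unfolding eta_def using equiv_class_self[OF equiv_ideal_cong[OF Rad_ideal] assms(1)] .
  moreover have "g x' = g x" if "x' \<in> eta A x" for x'
    using that unfolding eta_def by (intro assms(2)) simp
  ultimately show ?thesis by (intro SUP_eq_const) blast+
qed

lemma eta_ops:
  assumes x: "x \<in> carrier A"
  shows "y \<in> carrier A \<Longrightarrow> eta A x \<oplus>\<^bsub>S_alg A\<^esub> eta A y = eta A (x \<oplus> y)"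
    and "\<^bold>\<not>\<^bsub>S_alg A\<^esub> eta A x = eta A (\<^bold>\<not> x)"
proof -
  let ?R = "ideal_cong A (Rad A)"
  note E = equiv_class_eq[OF equiv_ideal_cong[OF Rad_ideal], symmetric]
  have refl: "(z, z) \<in> ?R" if "z \<in> carrier A" for z
    using that equiv_ideal_cong[OF Rad_ideal] by (auto elim: equivE dest: refl_onD)
  show "eta A x \<oplus>\<^bsub>S_alg A\<^esub> eta A y = eta A (x \<oplus> y)" if y: "y \<in> carrier A"
  proof -
    \<comment> \<open>The inner union collapses for each fixed representative of the first class;
      the outer one is treated afterwards.\<close>
    have "(\<Union>y'\<in>eta A y. ?R `` {x' \<oplus> y'}) = ?R `` {x' \<oplus> y}" if "x' \<in> carrier A" for x'
      using that y by (intro UN_eta_eq E ideal_cong_plus[OF Rad_ideal]) (auto intro: refl)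
    moreover have "x' \<in> carrier A" if "x' \<in> eta A x" for x'
      using that by (auto simp: eta_def ideal_cong_def)
    ultimately have "eta A x \<oplus>\<^bsub>S_alg A\<^esub> eta A y = (\<Union>x'\<in>eta A x. ?R `` {x' \<oplus> y})"
      by (simp add: S_alg_def mv_quotient_def)
    also have "\<dots> = eta A (x \<oplus> y)"
      unfolding eta_def[of A "x \<oplus> y"]
      using x y by (intro UN_eta_eq E ideal_cong_plus[OF Rad_ideal]) (auto intro: refl)
    finally show ?thesis .
  qed
  show "\<^bold>\<not>\<^bsub>S_alg A\<^esub> eta A x = eta A (\<^bold>\<not> x)"
    using x by (simp add: S_alg_def mv_quotient_def eta_def[of A "\<^bold>\<not> x"])
      (intro UN_eta_eq E ideal_cong_neg[OF Rad_ideal]; simp)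
qed

lemma carrier_S_alg: "carrier (S_alg A) = eta A ` carrier A"
  by (auto simp: S_alg_def mv_quotient_def quotient_def eta_def)

lemma zero_S_alg: "\<zero>\<^bsub>S_alg A\<^esub> = eta A \<zero>"
  by (simp add: S_alg_def mv_quotient_def eta_def)

lemma eta_hom: "eta A \<in> mv_hom A (S_alg A)"
  by (rule mv_homI) (auto simp: carrier_S_alg zero_S_alg eta_ops)

end

section \<open>The radical and homomorphisms\<close>

locale mv_morphism = A: mv_algebra A + B: mv_algebra B
  for A :: "'a mv" and B :: "'b mv" +
  fixes f :: "'a \<Rightarrow> 'b"
  assumes hom: "f \<in> mv_hom A B"
begin

lemmas H [simp] = mv_homD[OF hom]

lemma map_minus [simp]:
  "\<lbrakk>x \<in> carrier A; y \<in> carrier A\<rbrakk> \<Longrightarrow> f (x \<ominus>\<^bsub>A\<^esub> y) = f x \<ominus>\<^bsub>B\<^esub> f y"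
  by (simp add: mv_minus_def)

lemma map_dist [simp]:
  "\<lbrakk>x \<in> carrier A; y \<in> carrier A\<rbrakk> \<Longrightarrow> f (mv_dist A x y) = mv_dist B (f x) (f y)"
  by (simp add: mv_dist_def)

lemma map_one [simp]: "f \<one>\<^bsub>A\<^esub> = \<one>\<^bsub>B\<^esub>"
  using H(3)[OF A.zero_closed] by simp

lemma map_mult [simp]: "x \<in> carrier A \<Longrightarrow> f (A.mult n x) = B.mult n (f x)"
  by (induction n) auto

lemma map_le:
  assumes "x \<in> carrier A" "y \<in> carrier A" "mv_le A x y"
  shows "mv_le B (f x) (f y)"
  using assms map_one by (metis H(2,3) A.neg_closed mv_le_def)

text \<open>By \<open>Rad_iff\<close> membership is a family of inequalities between terms, and a
  morphism preserves these. This makes \<open>S_map\<close> well defined on classes.\<close>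

lemma map_Rad: "x \<in> Rad A \<Longrightarrow> f x \<in> Rad B"
  unfolding A.Rad_iff B.Rad_iff using map_le[of "A.mult n x" "\<^bold>\<not>\<^bsub>A\<^esub> x" for n] by simp

lemma S_map_eta:
  assumes x: "x \<in> carrier A" shows "S_map B f (eta A x) = eta B (f x)"
  unfolding S_map_def
proof (rule A.UN_eta_eq[OF x])
  fix x' assume "(x, x') \<in> ideal_cong A (Rad A)"
  then have x': "x' \<in> carrier A" "mv_dist A x x' \<in> Rad A" by (auto simp: ideal_cong_def)
  then have "mv_dist B (f x) (f x') \<in> Rad B" using map_Rad[OF x'(2)] x by simp
  then have "eta B (f x) = eta B (f x')" using B.eta_eq_iff x x' by simp
  then show "eta B (f x') = eta B (f x)" by simp
qed

lemma S_map_hom: "S_map B f \<in> mv_hom (S_alg A) (S_alg B)"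
  by (rule mv_homI)
    (auto simp: A.carrier_S_alg B.carrier_S_alg A.zero_S_alg B.zero_S_alg
      A.eta_ops B.eta_ops S_map_eta)

text \<open>The two clauses are injectivity and surjectivity of the comparison map \<open>?k\<close>
  into the pullback. Classes are replaced by representatives and equality of classes by a distance
  in the radical.\<close>

lemma trivial_extension_iff:
  "trivial_extension A B f \<longleftrightarrow>
    (\<forall>x\<in>Rad A. f x = \<zero>\<^bsub>B\<^esub> \<longrightarrow> x = \<zero>\<^bsub>A\<^esub>) \<and>
    (\<forall>x\<in>carrier A. \<forall>b\<in>carrier B. mv_dist B (f x) b \<in> Rad B \<longrightarrow>
       (\<exists>y\<in>carrier A. mv_dist A y x \<in> Rad A \<and> f y = b))"
  (is "_ \<longleftrightarrow> ?inj \<and> ?surj")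
proof -
  let ?R = "mv_pullback (S_alg A) (S_map B f) B (eta B)"
  let ?k = "\<lambda>z. (eta A z, f z)"
  have khom: "?k \<in> mv_hom A ?R"
    using mv_homD[OF A.eta_hom] by (intro mv_homI) (auto simp: S_map_eta)
  have "trivial_extension A B f \<longleftrightarrow> bij_betw ?k (carrier A) (carrier ?R)"
    using khom hom A.eta_hom B.eta_hom S_map_hom S_map_eta
    by (auto simp: trivial_extension_def is_pullback_def mv_iso_def)
  also have "\<dots> \<longleftrightarrow> inj_on ?k (carrier A) \<and> carrier ?R \<subseteq> ?k ` carrier A"
    using mv_homD(1)[OF khom] by (auto simp: bij_betw_def)
  also have "inj_on ?k (carrier A) \<longleftrightarrow> ?inj"
  proof
    assume inj: "inj_on ?k (carrier A)"
    show ?inj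
    proof (intro ballI impI)
      fix x assume x: "x \<in> Rad A" "f x = \<zero>\<^bsub>B\<^esub>"
      then have xA: "x \<in> carrier A" by (simp add: A.Rad_iff)
      have "mv_dist A x \<zero>\<^bsub>A\<^esub> = x" using xA by (simp add: mv_dist_def mv_minus_def)
      then have "eta A x = eta A \<zero>\<^bsub>A\<^esub>" using x xA by (simp add: A.eta_eq_iff)
      then show "x = \<zero>\<^bsub>A\<^esub>" using inj_onD[OF inj, of x "\<zero>\<^bsub>A\<^esub>"] x xA by simp
    qed
  next
    assume inj: ?inj
    show "inj_on ?k (carrier A)"
    proof (rule inj_onI)
      fix x y assume xy: "x \<in> carrier A" "y \<in> carrier A" "?k x = ?k y"
      \<comment> \<open>Two points with the same image under \<open>?k\<close> have a distance that
        is infinitesimal and killed by \<open>f\<close>.\<close>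
      then have "mv_dist A x y \<in> Rad A" "f (mv_dist A x y) = \<zero>\<^bsub>B\<^esub>"
        by (simp_all add: A.eta_eq_iff B.dist_eq_zero_iff)
      then show "x = y" using inj xy A.dist_eq_zero_iff by blast
    qed
  qed
  also have "carrier ?R \<subseteq> ?k ` carrier A \<longleftrightarrow> ?surj"
  proof
    assume sub: "carrier ?R \<subseteq> ?k ` carrier A"
    show ?surj
    proof (intro ballI impI)
      fix x b assume xb: "x \<in> carrier A" "b \<in> carrier B" "mv_dist B (f x) b \<in> Rad B"
      then have "(eta A x, b) \<in> carrier ?R"
        by (auto simp: A.carrier_S_alg S_map_eta B.eta_eq_iff)
      then obtain y where "y \<in> carrier A" "eta A x = eta A y" "b = f y"
        using sub by blast
      then show "\<exists>y\<in>carrier A. mv_dist A y x \<in> Rad A \<and> f y = b"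
        using xb by (metis A.eta_eq_iff)
    qed
  next
    assume surj: ?surj
    show "carrier ?R \<subseteq> ?k ` carrier A"
    proof
      fix w assume w: "w \<in> carrier ?R"
      then obtain x b where x: "w = (eta A x, b)" "x \<in> carrier A" "b \<in> carrier B"
        by (cases w) (auto simp: A.carrier_S_alg)
      then have "mv_dist B (f x) b \<in> Rad B" using w by (simp add: S_map_eta B.eta_eq_iff)
      then obtain y where y: "y \<in> carrier A" "mv_dist A y x \<in> Rad A" "f y = b"
        using surj x by blast
      then have "eta A y = eta A x" using x by (simp add: A.eta_eq_iff)
      then have "w = ?k y" using x y by simp
      then show "w \<in> ?k ` carrier A" using y by blast
    qed
  qed
  finally show ?thesis .
qed

section \<open>The kernel pair\<close>

lemma kernel_pair_simps [simp]:
  "(x, y) \<in> carrier (kernel_pair A f) \<longleftrightarrow> x \<in> carrier A \<and> y \<in> carrier A \<and> f x = f y"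
  "(x, y) \<oplus>\<^bsub>kernel_pair A f\<^esub> (x', y') = (x \<oplus>\<^bsub>A\<^esub> x', y \<oplus>\<^bsub>A\<^esub> y')"
  "\<^bold>\<not>\<^bsub>kernel_pair A f\<^esub> (x, y) = (\<^bold>\<not>\<^bsub>A\<^esub> x, \<^bold>\<not>\<^bsub>A\<^esub> y)"
  "\<zero>\<^bsub>kernel_pair A f\<^esub> = (\<zero>\<^bsub>A\<^esub>, \<zero>\<^bsub>A\<^esub>)"
  by (simp_all add: kernel_pair_def)

lemma kernel_pair_algebra: "mv_algebra (kernel_pair A f)"
  unfolding kernel_pair_def
  by (rule mv_algebra_pullback[OF A.mv_algebra_axioms A.mv_algebra_axioms hom hom])

lemma kernel_pair_morphisms:
  "mv_morphism (kernel_pair A f) A fst" "mv_morphism (kernel_pair A f) A snd"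
  using kernel_pair_algebra A.mv_algebra_axioms
  by (auto simp: mv_morphism_def mv_morphism_axioms_def kernel_pair_def intro!: mv_homI)

text \<open>Multiples and order in the kernel pair are componentwise, hence so is infinitesimality.
  The maximal ideals of the kernel pair never have to be described.\<close>

lemma Rad_kernel_pair:
  "(x, y) \<in> Rad (kernel_pair A f) \<longleftrightarrow> x \<in> Rad A \<and> y \<in> Rad A \<and> f x = f y"
proof -
  interpret K: mv_algebra "kernel_pair A f" by (rule kernel_pair_algebra)
  have "K.mult n (x, y) = (A.mult n x, A.mult n y)" for n
    by (induction n) simp_all
  moreover have "mv_le (kernel_pair A f) (a, b) (c, d) \<longleftrightarrow> mv_le A a c \<and> mv_le A b d" for a b c d
    by (simp add: mv_le_def mv_one_def del: A.neg_zero)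
  ultimately show ?thesis
    unfolding K.Rad_iff A.Rad_iff by auto
qed

lemma dist_kernel_pair:
  "mv_dist (kernel_pair A f) (x, y) (x', y') = (mv_dist A x x', mv_dist A y y')"
  by (simp add: mv_dist_def mv_minus_def)

text \<open>The witness applies to \<open>y\<close> the translation by elements of the radical that takes
  \<open>x\<close> to \<open>a\<close>. This makes the surjectivity half of the pullback condition automatic.\<close>

lemma shift_mod_Rad:
  assumes c: "x \<in> carrier A" "y \<in> carrier A" "a \<in> carrier A"
    and fxy: "f x = f y" and r: "mv_dist A x a \<in> Rad A"
  shows "\<exists>b\<in>carrier A. f b = f a \<and> mv_dist A b y \<in> Rad A"
proof
  let ?b = "(y \<oplus>\<^bsub>A\<^esub> (a \<ominus>\<^bsub>A\<^esub> x)) \<ominus>\<^bsub>A\<^esub> (x \<ominus>\<^bsub>A\<^esub> a)"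
  show b: "?b \<in> carrier A" using c by simp
  \<comment> \<open>As \<open>f y\<close> equals \<open>f x\<close>, the image of \<open>?b\<close>
    is the expression of \<open>join_minus_minus\<close> for \<open>f x\<close> and
    \<open>f a\<close>.\<close>
  have "f ?b = f a" using c B.join_minus_minus[of "f x" "f a"] by (simp add: fxy)
  moreover have "mv_dist A ?b y \<in> Rad A"
  proof -
    have xa: "x \<ominus>\<^bsub>A\<^esub> a \<in> Rad A" "a \<ominus>\<^bsub>A\<^esub> x \<in> Rad A"
      using r c A.dist_in_ideal_iff[OF A.Rad_ideal] by auto
    have "mv_le A (?b \<ominus>\<^bsub>A\<^esub> y) (a \<ominus>\<^bsub>A\<^esub> x)" using c by (simp add: A.residuation A.le_plus2)
    moreover have "mv_le A (y \<ominus>\<^bsub>A\<^esub> ?b) (x \<ominus>\<^bsub>A\<^esub> a)"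
    proof -
      have "mv_le A y (y \<oplus>\<^bsub>A\<^esub> (a \<ominus>\<^bsub>A\<^esub> x))" using c by (simp add: A.le_plus1)
      moreover have "mv_le A (y \<oplus>\<^bsub>A\<^esub> (a \<ominus>\<^bsub>A\<^esub> x)) ((x \<ominus>\<^bsub>A\<^esub> a) \<oplus>\<^bsub>A\<^esub> ?b)"
        using c by (simp add: A.le_plus_minus)
      ultimately have "mv_le A y ((x \<ominus>\<^bsub>A\<^esub> a) \<oplus>\<^bsub>A\<^esub> ?b)"
        using c b A.le_trans[of y "y \<oplus>\<^bsub>A\<^esub> (a \<ominus>\<^bsub>A\<^esub> x)"] by simp
      then show ?thesis using c b A.plus_comm[of "x \<ominus>\<^bsub>A\<^esub> a" ?b] by (simp add: A.residuation)
    qed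
    ultimately show ?thesis
      using c b xa A.dist_in_ideal_iff[OF A.Rad_ideal] A.idealD(4)[OF A.Rad_ideal] by blast
  qed
  ultimately show "f ?b = f a \<and> mv_dist A ?b y \<in> Rad A" by blast
qed

text \<open>This is the surjectivity clause of \<open>trivial_extension_iff\<close> for
  \<open>fst\<close>: the first coordinate is prescribed and \<open>shift_mod_Rad\<close> supplies
  the second.\<close>

lemma kernel_pair_lift:
  assumes xy: "(x, y) \<in> carrier (kernel_pair A f)" and a: "a \<in> carrier A" "mv_dist A x a \<in> Rad A"
  shows "\<exists>b. (a, b) \<in> carrier (kernel_pair A f) \<and>
    mv_dist (kernel_pair A f) (a, b) (x, y) \<in> Rad (kernel_pair A f)"
proof -
  have c: "x \<in> carrier A" "y \<in> carrier A" "f x = f y" using xy by simp_all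
  then obtain b where b: "b \<in> carrier A" "f b = f a" "mv_dist A b y \<in> Rad A"
    using shift_mod_Rad[of x y a] a by blast
  moreover have "mv_dist A a x \<in> Rad A" using a c by (simp add: mv_dist_def A.plus_comm)
  ultimately show ?thesis
    using a c by (intro exI[of _ b]) (simp add: dist_kernel_pair Rad_kernel_pair)
qed

lemma kernel_pair_swap:
  "(x, y) \<in> carrier (kernel_pair A f) \<longleftrightarrow> (y, x) \<in> carrier (kernel_pair A f)"
  "(x, y) \<in> Rad (kernel_pair A f) \<longleftrightarrow> (y, x) \<in> Rad (kernel_pair A f)"
  by (auto simp: Rad_kernel_pair)

lemma kernel_pair_lift':
  assumes "(x, y) \<in> carrier (kernel_pair A f)" "a \<in> carrier A" "mv_dist A y a \<in> Rad A"
  shows "\<exists>b. (b, a) \<in> carrier (kernel_pair A f) \<and>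
    mv_dist (kernel_pair A f) (b, a) (x, y) \<in> Rad (kernel_pair A f)"
  using kernel_pair_lift[of y x a] assms kernel_pair_swap unfolding dist_kernel_pair by blast

lemma trivial_kernel_pair_iff:
  shows "trivial_extension (kernel_pair A f) A fst \<longleftrightarrow>
           (\<forall>x\<in>Rad A. f x = \<zero>\<^bsub>B\<^esub> \<longrightarrow> x = \<zero>\<^bsub>A\<^esub>)"
    and "trivial_extension (kernel_pair A f) A snd \<longleftrightarrow>
           (\<forall>x\<in>Rad A. f x = \<zero>\<^bsub>B\<^esub> \<longrightarrow> x = \<zero>\<^bsub>A\<^esub>)"
proof -
  have zero: "\<zero>\<^bsub>A\<^esub> \<in> Rad A" by (rule A.idealD(2)[OF A.Rad_ideal])
  \<comment> \<open>A radical pair with first coordinate zero is (0, y) with \<open>y\<close> in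
    \<open>Rad A\<close> and f y = f 0 = 0.\<close>
  have fst_inj: "(\<forall>z\<in>Rad (kernel_pair A f). fst z = \<zero>\<^bsub>A\<^esub> \<longrightarrow> z = \<zero>\<^bsub>kernel_pair A f\<^esub>) \<longleftrightarrow>
       (\<forall>x\<in>Rad A. f x = \<zero>\<^bsub>B\<^esub> \<longrightarrow> x = \<zero>\<^bsub>A\<^esub>)"
    unfolding Ball_def split_paired_All Rad_kernel_pair kernel_pair_simps fst_conv prod.inject
    using zero H(4) by metis
  have snd_inj: "(\<forall>z\<in>Rad (kernel_pair A f). snd z = \<zero>\<^bsub>A\<^esub> \<longrightarrow> z = \<zero>\<^bsub>kernel_pair A f\<^esub>) \<longleftrightarrow>
       (\<forall>x\<in>Rad A. f x = \<zero>\<^bsub>B\<^esub> \<longrightarrow> x = \<zero>\<^bsub>A\<^esub>)"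
    unfolding Ball_def split_paired_All Rad_kernel_pair kernel_pair_simps snd_conv prod.inject
    using zero H(4) by metis
  have fst_surj: "\<forall>z\<in>carrier (kernel_pair A f). \<forall>a\<in>carrier A. mv_dist A (fst z) a \<in> Rad A \<longrightarrow>
    (\<exists>w\<in>carrier (kernel_pair A f).
       mv_dist (kernel_pair A f) w z \<in> Rad (kernel_pair A f) \<and> fst w = a)"
    by (metis kernel_pair_lift fst_conv surj_pair)
  have snd_surj: "\<forall>z\<in>carrier (kernel_pair A f). \<forall>a\<in>carrier A. mv_dist A (snd z) a \<in> Rad A \<longrightarrow>
    (\<exists>w\<in>carrier (kernel_pair A f).
       mv_dist (kernel_pair A f) w z \<in> Rad (kernel_pair A f) \<and> snd w = a)"
    by (metis kernel_pair_lift' snd_conv surj_pair)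
  show
    "trivial_extension (kernel_pair A f) A fst \<longleftrightarrow>
       (\<forall>x\<in>Rad A. f x = \<zero>\<^bsub>B\<^esub> \<longrightarrow> x = \<zero>\<^bsub>A\<^esub>)"
    "trivial_extension (kernel_pair A f) A snd \<longleftrightarrow>
       (\<forall>x\<in>Rad A. f x = \<zero>\<^bsub>B\<^esub> \<longrightarrow> x = \<zero>\<^bsub>A\<^esub>)"
    unfolding kernel_pair_morphisms[THEN mv_morphism.trivial_extension_iff] fst_inj snd_inj
    using fst_surj snd_surj by simp_all
qed

end

section \<open>Injectivity on the perfect part\<close>

context mv_algebra
begin

lemma carrier_P: "carrier (P_alg A) = Rad A \<union> {x \<in> carrier A. \<^bold>\<not> x \<in> Rad A}"
  by (simp add: P_alg_def)

text \<open>Infinitesimality of 1 for the single multiple n = 1 already reads 1 \<le> \<not> 1 =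
  0.\<close>

lemma one_in_Rad: "\<one> \<in> Rad A \<Longrightarrow> \<one> = \<zero>"
  using le_antisym[of \<one> \<zero>] by (force simp: Rad_iff dest: spec[of _ 1])

lemma trivial_carrier:
  assumes "\<one> = \<zero>" shows "carrier A = {\<zero>}"
proof -
  have "x = \<zero>" if "x \<in> carrier A" for x
    using that assms plus_one[of x] by simp
  then show ?thesis by auto
qed

text \<open>This allows injectivity on \<open>P_alg A\<close> to be tested at zero. Two
  infinitesimals are at infinitesimal distance; if \<open>u\<close> and \<not> v are infinitesimal,
  the distance lies above \<open>v \<ominus> u\<close>, whose negation is infinitesimal. Negation
  and symmetry reduce the other cases to these.\<close>

lemma P_dist:
  assumes x: "x \<in> carrier (P_alg A)" and y: "y \<in> carrier (P_alg A)"
  shows "mv_dist A x y \<in> carrier (P_alg A)"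
proof -
  note I = idealD[OF Rad_ideal]
  have c: "x \<in> carrier A" "y \<in> carrier A" using x y by (auto simp: carrier_P Rad_def)
  have *: "mv_dist A u v \<in> Rad A" if "u \<in> Rad A" "v \<in> Rad A" for u v
    using I(1)[OF that(1)] I(1)[OF that(2)] I(4)[OF that(1), of "u \<ominus> v"] I(4)[OF that(2), of "v \<ominus> u"]
    by (simp add: dist_in_ideal_iff[OF Rad_ideal] minus_le)
  have **: "\<^bold>\<not> mv_dist A u v \<in> Rad A"
    if "u \<in> Rad A" "\<^bold>\<not> v \<in> Rad A" "v \<in> carrier A" for u v
  proof -
    have u: "u \<in> carrier A" using that I(1) by simp
    have "\<^bold>\<not> (v \<ominus> u) \<in> Rad A" using that u I(3) by (simp add: neg_minus)
    from I(4)[OF this, of "\<^bold>\<not> mv_dist A u v"] show ?thesis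
      using u that by (simp add: neg_antimono mv_dist_def le_plus2)
  qed
  have neg: "mv_dist A (\<^bold>\<not> x) (\<^bold>\<not> y) = mv_dist A x y" and comm: "mv_dist A y x = mv_dist A x y"
    using c by (simp_all add: mv_dist_def neg_minus_neg plus_comm)
  consider "x \<in> Rad A" "y \<in> Rad A" | "\<^bold>\<not> x \<in> Rad A" "\<^bold>\<not> y \<in> Rad A"
    | "x \<in> Rad A" "\<^bold>\<not> y \<in> Rad A" | "y \<in> Rad A" "\<^bold>\<not> x \<in> Rad A"
    using x y by (auto simp: carrier_P)
  then have "mv_dist A x y \<in> Rad A \<or> \<^bold>\<not> mv_dist A x y \<in> Rad A"
  proof cases
    case 1 then show ?thesis using * by blast
  next
    case 2 then show ?thesis using *[OF 2] by (simp add: neg)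
  next
    case 3 then show ?thesis using **[OF 3 c(2)] by simp
  next
    case 4 then show ?thesis using **[OF 4 c(1)] by (simp add: comm)
  qed
  then show ?thesis using c by (simp add: carrier_P)
qed

lemma P_isomorphic_two:
  assumes "\<one> \<noteq> \<zero>" "Rad A = {\<zero>}"
  shows "mv_isomorphic (P_alg A) two_mv"
proof -
  have P: "carrier (P_alg A) = {\<zero>, \<one>}"
  proof -
    have "\<^bold>\<not> x = \<zero> \<longleftrightarrow> x = \<one>" if "x \<in> carrier A" for x
      using neg_neg[OF that] by auto
    then have "{x \<in> carrier A. \<^bold>\<not> x \<in> Rad A} = {\<one>}" unfolding assms(2) by blast
    then show ?thesis unfolding carrier_P assms(2) by auto
  qed
  have "(\<lambda>x. x = \<one>) \<in> mv_iso (P_alg A) two_mv"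
    unfolding mv_iso_def mv_hom_def bij_betw_def inj_on_def P
    using assms(1) by (auto simp: P_alg_def two_mv_def)
  then show ?thesis unfolding mv_isomorphic_def by blast
qed

lemma P_isomorphic_one:
  assumes "\<one> = \<zero>" shows "mv_isomorphic (P_alg A) one_mv"
proof -
  have P: "carrier (P_alg A) = {\<zero>}"
    using trivial_carrier[OF assms] idealD(2)[OF Rad_ideal] by (auto simp: carrier_P Rad_def)
  have "(\<lambda>x. ()) \<in> mv_iso (P_alg A) one_mv"
    unfolding mv_iso_def mv_hom_def bij_betw_def P by (auto simp: one_mv_def)
  then show ?thesis unfolding mv_isomorphic_def by blast
qed

text \<open>The isomorphism separates 0 from 1 and so takes both of its values there. By injectivity
  \<open>P_alg A\<close> has no further elements, and \<open>one_in_Rad\<close> handles the case of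
  1 in the radical.\<close>

lemma Rad_if_P_isomorphic_two:
  assumes "mv_isomorphic (P_alg A) two_mv" shows "Rad A = {\<zero>}"
proof -
  obtain h where h: "h \<in> mv_hom (P_alg A) two_mv" "bij_betw h (carrier (P_alg A)) UNIV"
    using assms by (auto simp: mv_isomorphic_def mv_iso_def two_mv_def)
  have z: "\<zero> \<in> Rad A" by (rule idealD(2)[OF Rad_ideal])
  then have zP: "\<zero> \<in> carrier (P_alg A)" "\<one> \<in> carrier (P_alg A)" by (auto simp: carrier_P)
  have h0: "\<not> h \<zero>" using mv_homD(4)[OF h(1)] by (simp add: P_alg_def two_mv_def)
  have h1: "h \<one>" using mv_homD(3)[OF h(1) zP(1)] h0 by (simp add: P_alg_def two_mv_def)
  have "x = \<zero>" if x: "x \<in> Rad A" for x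
  proof -
    have "x \<in> carrier (P_alg A)" using x by (simp add: carrier_P)
    then have "x = \<zero> \<or> x = \<one>"
      using h0 h1 zP inj_onD[OF bij_betw_imp_inj_on[OF h(2)]] by metis
    then show ?thesis using one_in_Rad x by auto
  qed
  then show ?thesis using z by blast
qed

end

context mv_morphism
begin

lemma inj_on_P_iff:
  "inj_on (P_map A f) (carrier (P_alg A)) \<longleftrightarrow>
    (\<forall>x\<in>carrier (P_alg A). f x = \<zero>\<^bsub>B\<^esub> \<longrightarrow> x = \<zero>\<^bsub>A\<^esub>)"
proof -
  have sub: "carrier (P_alg A) \<subseteq> carrier A" by (auto simp: A.carrier_P Rad_def)
  have z: "\<zero>\<^bsub>A\<^esub> \<in> carrier (P_alg A)" using A.idealD(2)[OF A.Rad_ideal] by (simp add: A.carrier_P)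
  have "inj_on (P_map A f) (carrier (P_alg A)) \<longleftrightarrow> inj_on f (carrier (P_alg A))"
    by (simp add: P_map_def inj_on_restrict_eq)
  also have "\<dots> \<longleftrightarrow> (\<forall>x\<in>carrier (P_alg A). f x = \<zero>\<^bsub>B\<^esub> \<longrightarrow> x = \<zero>\<^bsub>A\<^esub>)"
  proof
    show "\<forall>x\<in>carrier (P_alg A). f x = \<zero>\<^bsub>B\<^esub> \<longrightarrow> x = \<zero>\<^bsub>A\<^esub>" if "inj_on f (carrier (P_alg A))"
      using inj_onD[OF that _ _ z] by simp
    assume ker: "\<forall>x\<in>carrier (P_alg A). f x = \<zero>\<^bsub>B\<^esub> \<longrightarrow> x = \<zero>\<^bsub>A\<^esub>"
    show "inj_on f (carrier (P_alg A))"
    proof (rule inj_onI)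
      fix x y assume xy: "x \<in> carrier (P_alg A)" "y \<in> carrier (P_alg A)" "f x = f y"
      then have c: "x \<in> carrier A" "y \<in> carrier A" using sub by auto
      then have "f (mv_dist A x y) = \<zero>\<^bsub>B\<^esub>" using xy(3) by (simp add: B.dist_eq_zero_iff)
      then have "mv_dist A x y = \<zero>\<^bsub>A\<^esub>" using ker A.P_dist xy by blast
      then show "x = y" using c by (simp add: A.dist_eq_zero_iff)
    qed
  qed
  finally show ?thesis .
qed

lemma Rad_ker_iff:
  "(\<forall>x\<in>Rad A. f x = \<zero>\<^bsub>B\<^esub> \<longrightarrow> x = \<zero>\<^bsub>A\<^esub>) \<longleftrightarrow>
    inj_on (P_map A f) (carrier (P_alg A)) \<or>
    (mv_isomorphic (P_alg A) two_mv \<and> mv_isomorphic (P_alg B) one_mv)"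
  (is "?ker \<longleftrightarrow> _ \<or> ?two")
proof
  assume ker: ?ker
  have ?two if ninj: "\<not> inj_on (P_map A f) (carrier (P_alg A))"
  proof -
    \<comment> \<open>\<open>?ker\<close> rules out a witness in the radical, so the negation of
      \<open>x\<close> is infinitesimal, and \<open>f\<close> maps that negation to 1.\<close>
    obtain x where x: "x \<in> carrier A" "\<^bold>\<not>\<^bsub>A\<^esub> x \<in> Rad A" "f x = \<zero>\<^bsub>B\<^esub>" "x \<noteq> \<zero>\<^bsub>A\<^esub>"
      using ker ninj unfolding inj_on_P_iff by (auto simp: A.carrier_P)
    have "\<one>\<^bsub>B\<^esub> \<in> Rad B" using map_Rad[OF x(2)] x by simp
    then have B: "\<one>\<^bsub>B\<^esub> = \<zero>\<^bsub>B\<^esub>" by (rule B.one_in_Rad)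
    have "f y = \<zero>\<^bsub>B\<^esub>" if "y \<in> carrier A" for y
      using H(1)[OF that] B.trivial_carrier[OF B] by simp
    then have "Rad A = {\<zero>\<^bsub>A\<^esub>}"
      using ker A.idealD(1,2)[OF A.Rad_ideal] by blast
    moreover have "\<one>\<^bsub>A\<^esub> \<noteq> \<zero>\<^bsub>A\<^esub>" using x A.trivial_carrier by auto
    ultimately show ?two using A.P_isomorphic_two B.P_isomorphic_one[OF B] by blast
  qed
  then show "inj_on (P_map A f) (carrier (P_alg A)) \<or> ?two" by blast
next
  assume "inj_on (P_map A f) (carrier (P_alg A)) \<or> ?two"
  \<comment> \<open>The radical is contained in \<open>P_alg A\<close>, where injectivity applies;
    in the second case it consists of zero alone.\<close>
  then show ?ker
    using A.Rad_if_P_isomorphic_two unfolding inj_on_P_iff by (auto simp: A.carrier_P)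
qed

end

theorem proposition5p10:
  fixes A B :: "'u mv" and f :: "'u \<Rightarrow> 'u"
  assumes "mv_algebra A" and "mv_algebra B"
    and "f \<in> mv_hom A B"
    and "effective_descent A B f"
  shows "normal_extension A B f \<longleftrightarrow>
           inj_on (P_map A f) (carrier (P_alg A)) \<or>
           (mv_isomorphic (P_alg A) two_mv \<and> mv_isomorphic (P_alg B) one_mv)"
proof -
  interpret mv_morphism A B f
    using assms(1-3) by (simp add: mv_morphism_def mv_morphism_axioms_def)
  show ?thesis
    unfolding normal_extension_def trivial_kernel_pair_iff
    using assms(4) Rad_ker_iff by simp
qed

end
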